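(* Let $F_N$ be a free group of finite rank $N\ge 2$. For a basis $\mathcal A$ of $F_N$ and an algebraic lamination $L$ in $F_N$ let $X_{\mathcal A}(L)\subset\mathcal A_\pm^{\mathbb Z}$ be the subshift associated to $L$ via $\mathcal A$. For bases $\mathcal A,\mathcal B$ and an algebraic lamination $L$ write $X_\pm = X_{\mathcal A}(L)$ and $Y_\pm = X_{\mathcal B}(L)$, with complexity functions $p_{X_\pm}$, $p_{Y_\pm}$. Then: (1) For any bases $\mathcal A,\mathcal B$ of $F_N$ and any algebraic lamination $L$ in $F_N$ there exist constants $c,d,C,D>0$ such that $$c\cdot p_{X_\pm}(\lfloor d\cdot n\rfloor)\ \le\ p_{Y_\pm}(n)\ \le\ C\cdot p_{X_\pm}(\lfloor D\cdot n\rfloor)$$ for every sufficiently large integer $n\ge 0$. (2) In general statement (1) fails if in addition one imposes $c=d=1$; that is, there are bases $\mathcal A,\mathcal B$ and an algebraic lamination $L$ in $F_N$ for which no constants as in (1) with $c=d=1$ exist. Moreover, there are bases $\mathcal A$ and $\mathcal B$ and algebraic laminations $L$ in $F_N$ such that $p_{Y_\pm}\notin\Theta(p_{X_\pm})$. (3) The topological entropy of the subshift associated to an algebraic lamination is not independent of the basis: there are bases $\mathcal A,\mathcal B$ and an algebraic lamination $L$ in $F_N$ with $h_{X_\pm}\ne h_{Y_\pm}$. However, its vanishing is independent of the basis: for all bases $\mathcal A,\mathcal B$ of $F_N$ and every algebraic lamination $L$ in $F_N$ one has $h_{X_\pm}=0 \Longleftrightarrow h_{Y_\pm}=0$.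
   Context: A subshift over a finite alphabet $\mathcal C$ is a non-empty closed subset $X\subset\mathcal C^{\mathbb Z}$ (product topology, $\mathcal C$ discrete) invariant under the shift. Its language $\mathcal L(X)$ is the set of all finite words occurring as blocks of consecutive letters in elements of $X$; its complexity function is $p_X(n)=$ number of words of length $n$ in $\mathcal L(X)$; its topological entropy is $h_X=\lim_{n\to\infty}\frac{\log p_X(n)}{n}$. For functions $f,g:\mathbb N\to\mathbb R_{>0}$ one writes $f\in\Theta(g)$ if there are constants $c,C>0$ with $c\cdot g(n)\le f(n)\le C\cdot g(n)$ for all sufficiently large $n$. Algebraic laminations: let $\partial F_N$ be the Gromov boundary of $F_N$ and $\partial^2F_N=\{(\xi,\eta)\in\partial F_N\times\partial F_N:\xi\ne\eta\}$. An algebraic lamination in $F_N$ is a non-empty closed subset $L\subset\partial^2F_N$ which is invariant under the diagonal action of $F_N$ and under the flip $(\xi,\eta)\mapsto(\eta,\xi)$. For a basis $\mathcal A$ of $F_N$ put $\mathcal A_\pm=\mathcal A\cup\mathcal A^{-1}$, an alphabet with $2N$ letters. A biinfinite word in $\mathcal A_\pm^{\mathbb Z}$ is reduced if it contains no factor $aa^{-1}$ or $a^{-1}a$ with $a \in\mathcal A$. A reduced biinfinite word ${\bf x}=\ldots x_{-1}x_0x_1x_2\ldots$ determines the pair $(\xi,\eta)\in\partial^2F_N$, where $\eta$ is the boundary point given by the infinite reduced word $x_1x_2x_3\ldots$ and $\xi$ the one given by $x_0^{-1}x_{-1}^{-1}x_{-2}^{-1}\ldots$. The subshift $X_{\mathcal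 A}(L)\subset\mathcal A_\pm^{\mathbb Z}$ is the set of all reduced biinfinite words whose associated pair lies in $L$; $L\mapsto X_{\mathcal A}(L)$ is a bijection between algebraic laminations and those subshifts over $\mathcal A_\pm$ that consist of reduced biinfinite words and are closed under inversion $\ldots x_nx_{n+1}\ldots\mapsto\ldots x_{n+1}^{-1}x_n^{-1}\ldots$. *)

theory Defs
  imports "HOL-Algebra.Generated_Groups" "HOL-Analysis.Analysis" "HOL-Library.Landau_Symbols"
begin

section \<open>Words and free groups\<close>

definition letters :: "('g, 'm) monoid_scheme \<Rightarrow> 'g set \<Rightarrow> 'g set"
  where "letters G A = A \<union> (\<lambda>a. inv\<^bsub>G\<^esub> a) ` A"

definition word_prod :: "('g, 'm) monoid_scheme \<Rightarrow> 'g list \<Rightarrow> 'g"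
  where "word_prod G w = foldr (\<lambda>x y. x \<otimes>\<^bsub>G\<^esub> y) w \<one>\<^bsub>G\<^esub>"

definition reduced_words :: "('g, 'm) monoid_scheme \<Rightarrow> 'g set \<Rightarrow> 'g list set"
  where "reduced_words G A =
    {w. set w \<subseteq> letters G A \<and> successively (\<lambda>a b. b \<noteq> inv\<^bsub>G\<^esub> a) w}"

text \<open>
  Disjointness makes inversion a fixed-point free involution of the letters, so that words over
  \<^term>\<open>letters G A\<close> are the same as words in formal letters and their formal inverses. It excludes
  elements of order two and bases containing an element together with its inverse.
\<close>
definition free_basis :: "('g, 'm) monoid_scheme \<Rightarrow> 'g set \<Rightarrow> bool"
  where "free_basis G A \<longleftrightarrow>
    A \<subseteq> carrier G \<and> A \<inter> (\<lambda>a. inv\<^bsub>G\<^esub> a) ` A = {} \<and>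
    bij_betw (word_prod G) (reduced_words G A) (carrier G)"

definition free_group_of_rank :: "('g, 'm) monoid_scheme \<Rightarrow> nat \<Rightarrow> bool"
  where "free_group_of_rank G N \<longleftrightarrow>
    group G \<and> (\<exists>A. free_basis G A \<and> finite A \<and> card A = N)"


section \<open>The Gromov boundary of a finitely generated group\<close>

text \<open>
  The boundary is formed with respect to the word metric of a finite generating set \<open>S\<close>, as the
  set of equivalence classes of sequences of group elements converging to infinity, with the
  neutral element as base point. For hyperbolic groups neither the classes nor the topology
  depend on \<open>S\<close>.
\<close>

definition word_length :: "('g, 'm) monoid_scheme \<Rightarrow> 'g set \<Rightarrow> 'g \<Rightarrow> nat"
  where "word_length G S g =
    (LEAST n. \<exists>w. set w \<subseteq> letters G S \<and> length w = n \<and> word_prod G w = g)"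

definition gromov_product :: "('g, 'm) monoid_scheme \<Rightarrow> 'g set \<Rightarrow> 'g \<Rightarrow> 'g \<Rightarrow> real"
  where "gromov_product G S g h =
    (real (word_length G S g) + real (word_length G S h)
      - real (word_length G S (inv\<^bsub>G\<^esub> g \<otimes>\<^bsub>G\<^esub> h))) / 2"

definition gromov_close ::
    "('g, 'm) monoid_scheme \<Rightarrow> 'g set \<Rightarrow> (nat \<Rightarrow> 'g) \<Rightarrow> (nat \<Rightarrow> 'g) \<Rightarrow> bool"
  where "gromov_close G S s t \<longleftrightarrow>
    filterlim (\<lambda>(i, j). gromov_product G S (s i) (t j)) at_top (sequentially \<times>\<^sub>F sequentially)"

definition converges_to_infinity ::
    "('g, 'm) monoid_scheme \<Rightarrow> 'g set \<Rightarrow> (nat \<Rightarrow> 'g) \<Rightarrow> bool"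
  where "converges_to_infinity G S s \<longleftrightarrow> range s \<subseteq> carrier G \<and> gromov_close G S s s"

definition boundary_point ::
    "('g, 'm) monoid_scheme \<Rightarrow> 'g set \<Rightarrow> (nat \<Rightarrow> 'g) \<Rightarrow> (nat \<Rightarrow> 'g) set"
  where "boundary_point G S s = {t. converges_to_infinity G S t \<and> gromov_close G S s t}"

definition gromov_boundary :: "('g, 'm) monoid_scheme \<Rightarrow> 'g set \<Rightarrow> (nat \<Rightarrow> 'g) set set"
  where "gromov_boundary G S = boundary_point G S ` {s. converges_to_infinity G S s}"

definition boundary_nbhd ::
    "('g, 'm) monoid_scheme \<Rightarrow> 'g set \<Rightarrow> (nat \<Rightarrow> 'g) set \<Rightarrow> real \<Rightarrow> (nat \<Rightarrow> 'g) set set"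
  where "boundary_nbhd G S \<xi> r =
    {\<eta> \<in> gromov_boundary G S. \<exists>s\<in>\<xi>. \<exists>t\<in>\<eta>.
      \<forall>\<^sub>F (i, j) in sequentially \<times>\<^sub>F sequentially. gromov_product G S (s i) (t j) \<ge> r}"

definition boundary_open :: "('g, 'm) monoid_scheme \<Rightarrow> 'g set \<Rightarrow> (nat \<Rightarrow> 'g) set set \<Rightarrow> bool"
  where "boundary_open G S U \<longleftrightarrow>
    U \<subseteq> gromov_boundary G S \<and> (\<forall>\<xi>\<in>U. \<exists>r. boundary_nbhd G S \<xi> r \<subseteq> U)"

definition boundary_topology ::
    "('g, 'm) monoid_scheme \<Rightarrow> 'g set \<Rightarrow> (nat \<Rightarrow> 'g) set topology"
  where "boundary_topology G S = topology (boundary_open G S)"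

lemma boundary_nbhd_antimono:
  assumes "r \<le> r'"
  shows "boundary_nbhd G S \<xi> r' \<subseteq> boundary_nbhd G S \<xi> r"
proof -
  have "\<forall>\<^sub>F (i, j) in F. gromov_product G S (s i) (t j) \<ge> r"
    if "\<forall>\<^sub>F (i, j) in F. gromov_product G S (s i) (t j) \<ge> r'" for s t F
    using that by (rule eventually_mono) (use assms in auto)
  then show ?thesis
    unfolding boundary_nbhd_def by blast
qed

lemma istopology_boundary_open: "istopology (boundary_open G S)"
  unfolding istopology_def
proof (intro conjI allI impI)
  fix U V assume U: "boundary_open G S U" and V: "boundary_open G S V"
  have "\<exists>r. boundary_nbhd G S \<xi> r \<subseteq> U \<inter> V" if "\<xi> \<in> U \<inter> V" for \<xi>
  proof -
    from that have "\<xi> \<in> U" "\<xi> \<in> V" by simp_all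
    obtain r where r: "boundary_nbhd G S \<xi> r \<subseteq> U"
      using U \<open>\<xi> \<in> U\<close> unfolding boundary_open_def by blast
    obtain r' where r': "boundary_nbhd G S \<xi> r' \<subseteq> V"
      using V \<open>\<xi> \<in> V\<close> unfolding boundary_open_def by blast
    have "boundary_nbhd G S \<xi> (max r r') \<subseteq> U"
      using boundary_nbhd_antimono[OF max.cobounded1] r by (rule subset_trans)
    moreover have "boundary_nbhd G S \<xi> (max r r') \<subseteq> V"
      using boundary_nbhd_antimono[OF max.cobounded2] r' by (rule subset_trans)
    ultimately have "boundary_nbhd G S \<xi> (max r r') \<subseteq> U \<inter> V"
      by (rule Int_greatest)
    then show ?thesis ..
  qed
  moreover have "U \<inter> V \<subseteq> gromov_boundary G S"
    using U unfolding boundary_open_def by (simp add: le_infI1)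
  ultimately show "boundary_open G S (U \<inter> V)"
    unfolding boundary_open_def by simp
next
  fix \<U> assume *: "\<forall>U\<in>\<U>. boundary_open G S U"
  have "\<exists>r. boundary_nbhd G S \<xi> r \<subseteq> \<Union>\<U>" if "\<xi> \<in> \<Union>\<U>" for \<xi>
  proof -
    from that obtain U where "U \<in> \<U>" "\<xi> \<in> U" ..
    then obtain r where "boundary_nbhd G S \<xi> r \<subseteq> U"
      using * unfolding boundary_open_def by blast
    then have "boundary_nbhd G S \<xi> r \<subseteq> \<Union>\<U>"
      using \<open>U \<in> \<U>\<close> by (simp add: Sup_upper2)
    then show ?thesis ..
  qed
  moreover have "\<Union>\<U> \<subseteq> gromov_boundary G S"
    using * by (simp add: Sup_le_iff boundary_open_def)
  ultimately show "boundary_open G S (\<Union>\<U>)"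
    unfolding boundary_open_def by simp
qed

lemma openin_boundary_topology: "openin (boundary_topology G S) = boundary_open G S"
  unfolding boundary_topology_def using istopology_boundary_open by (rule topology_inverse')

lemma topspace_boundary_topology: "topspace (boundary_topology G S) = gromov_boundary G S"
proof (rule antisym)
  have "boundary_open G S (topspace (boundary_topology G S))"
    by (metis openin_boundary_topology openin_topspace)
  then show "topspace (boundary_topology G S) \<subseteq> gromov_boundary G S"
    by (simp add: boundary_open_def)
  have "boundary_nbhd G S \<xi> 0 \<subseteq> gromov_boundary G S" for \<xi>
    unfolding boundary_nbhd_def by (rule Collect_restrict)
  then have "boundary_open G S (gromov_boundary G S)"
    by (simp add: boundary_open_def) blast
  then show "gromov_boundary G S \<subseteq> topspace (boundary_topology G S)"
    by (intro openin_subset) (simp add: openin_boundary_topology)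
qed

definition boundary_action :: "('g, 'm) monoid_scheme \<Rightarrow> 'g \<Rightarrow> (nat \<Rightarrow> 'g) set \<Rightarrow> (nat \<Rightarrow> 'g) set"
  where "boundary_action G g \<xi> = (\<lambda>s i. g \<otimes>\<^bsub>G\<^esub> s i) ` \<xi>"


section \<open>Algebraic laminations and their subshifts\<close>

definition double_boundary ::
    "('g, 'm) monoid_scheme \<Rightarrow> 'g set \<Rightarrow> ((nat \<Rightarrow> 'g) set \<times> (nat \<Rightarrow> 'g) set) set"
  where "double_boundary G S =
    {(\<xi>, \<eta>). \<xi> \<in> gromov_boundary G S \<and> \<eta> \<in> gromov_boundary G S \<and> \<xi> \<noteq> \<eta>}"

definition algebraic_lamination ::
    "('g, 'm) monoid_scheme \<Rightarrow> 'g set \<Rightarrow> ((nat \<Rightarrow> 'g) set \<times> (nat \<Rightarrow> 'g) set) set \<Rightarrow> bool"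
  where "algebraic_lamination G S L \<longleftrightarrow>
    L \<noteq> {} \<and>
    closedin (subtopology (prod_topology (boundary_topology G S) (boundary_topology G S))
      (double_boundary G S)) L \<and>
    (\<forall>g\<in>carrier G. \<forall>(\<xi>, \<eta>)\<in>L. (boundary_action G g \<xi>, boundary_action G g \<eta>) \<in> L) \<and>
    (\<forall>(\<xi>, \<eta>)\<in>L. (\<eta>, \<xi>) \<in> L)"

definition reduced_biinfinite :: "('g, 'm) monoid_scheme \<Rightarrow> 'g set \<Rightarrow> (int \<Rightarrow> 'g) set"
  where "reduced_biinfinite G A =
    {x. range x \<subseteq> letters G A \<and> (\<forall>k. x (k + 1) \<noteq> inv\<^bsub>G\<^esub> (x k))}"

text \<open>The infinite word \<open>y 0, y 1, \<dots>\<close> gives the boundary point represented by its prefixes.\<close>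
definition word_endpoint ::
    "('g, 'm) monoid_scheme \<Rightarrow> 'g set \<Rightarrow> (nat \<Rightarrow> 'g) \<Rightarrow> (nat \<Rightarrow> 'g) set"
  where "word_endpoint G S y = boundary_point G S (\<lambda>n. word_prod G (map y [0..<n]))"

definition endpoint_pair ::
    "('g, 'm) monoid_scheme \<Rightarrow> 'g set \<Rightarrow> (int \<Rightarrow> 'g) \<Rightarrow> (nat \<Rightarrow> 'g) set \<times> (nat \<Rightarrow> 'g) set"
  where "endpoint_pair G S x =
    (word_endpoint G S (\<lambda>i. inv\<^bsub>G\<^esub> (x (- int i))), word_endpoint G S (\<lambda>i. x (int i + 1)))"

definition lamination_subshift ::
    "('g, 'm) monoid_scheme \<Rightarrow> 'g set \<Rightarrow> 'g set \<Rightarrow>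
      ((nat \<Rightarrow> 'g) set \<times> (nat \<Rightarrow> 'g) set) set \<Rightarrow> (int \<Rightarrow> 'g) set"
  where "lamination_subshift G S A L = {x \<in> reduced_biinfinite G A. endpoint_pair G S x \<in> L}"


section \<open>Complexity and entropy\<close>

definition language :: "(int \<Rightarrow> 'c) set \<Rightarrow> 'c list set"
  where "language X = {map (\<lambda>i. x (k + int i)) [0..<n] | x k n. x \<in> X}"

definition complexity :: "(int \<Rightarrow> 'c) set \<Rightarrow> nat \<Rightarrow> nat"
  where "complexity X n = card {w \<in> language X. length w = n}"

definition topological_entropy :: "(int \<Rightarrow> 'c) set \<Rightarrow> real"
  where "topological_entropy X = lim (\<lambda>n. ln (real (complexity X n)) / real n)"

definition complexity_bounds ::
    "real \<Rightarrow> real \<Rightarrow> real \<Rightarrow> real \<Rightarrow> (nat \<Rightarrow> nat) \<Rightarrow> (nat \<Rightarrow> nat) \<Rightarrow> bool"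
  where "complexity_bounds c d C D p q \<longleftrightarrow>
    (\<forall>\<^sub>F n in sequentially.
      c * real (p (nat \<lfloor>d * real n\<rfloor>)) \<le> real (q n) \<and>
      real (q n) \<le> C * real (p (nat \<lfloor>D * real n\<rfloor>)))"

end

theory Submission imports Defs begin

text \<open>
  For a basis \<open>A\<close> the Gromov product of two elements is the length of the common prefix of their
  normal forms. A path whose steps have bounded length in the tree of \<open>A\<close> passes close to every
  vertex between its ends, so the Gromov products of \<open>A\<close> and of any finite generating set bound
  each other linearly. Hence the boundary does not depend on the generating set, its points are
  the infinite reduced words over \<open>A\<close>, and a prefix of the word over one basis determines a
  proportional prefix over any other one. This gives the bounds on complexity, and with them the
  invariance of zero entropy.

  For the negative statements take the full shift on \<open>{a, c}\<close> together with its inverse, where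
  \<open>c = a b\<close>. Its entropy is at least \<open>ln 2\<close>. Over the basis containing \<open>a\<close> and \<open>b\<close> the same
  lamination is a golden mean shift, as \<open>b\<close> is always preceded by \<open>a\<close>. That shift has at most
  \<open>2 * 3 ^ 3 < 2 ^ 6\<close> words of length 6, so its entropy is smaller. Different entropies exclude
  \<open>c = d = 1\<close> and \<open>\<Theta>\<close>-equivalence at once.
\<close>

section \<open>Words and normal forms\<close>

text \<open>The boundary consists of classes of sequences of group elements, formed with an
  arbitrary finite generating set \<open>S\<close>, while the subshifts are described by letters.
  The two sides meet in \<open>ray_end r\<close>, the set of all sequences whose normal forms
  converge to the infinite word \<open>r\<close>; two bases describe the same boundary point by two
  rays with the same \<open>ray_end\<close>. A pair of rays need not part at the base point, so the
  line joining their ends has to be translated there before it can be read as a biinfinite word; the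
  length \<open>k\<close> of the common prefix is therefore carried along. The lamination of the
  example is built over the old basis, because there admissibility concerns only pairs of
  consecutive letters. This makes it closed, lets invariance be checked one letter at a time, and
  bounds the number of words by counting pairs. Over the new basis it is enough to exhibit
  \<open>2 ^ n\<close> words of length \<open>n\<close>: each word in \<open>a\<close> and
  \<open>c\<close> is completed on both sides by the letter \<open>a\<close>, which belongs to both
  bases.\<close>

lemma word_prod_Nil [simp]: "word_prod G [] = \<one>\<^bsub>G\<^esub>"
  and word_prod_Cons [simp]: "word_prod G (a # w) = a \<otimes>\<^bsub>G\<^esub> word_prod G w"
  by (simp_all add: word_prod_def)

context group
begin

lemma word_prod_closed [intro, simp]: "set w \<subseteq> carrier G \<Longrightarrow> word_prod G w \<in> carrier G"
  by (induction w) auto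

lemma word_prod_append:
  "set v \<subseteq> carrier G \<Longrightarrow> set w \<subseteq> carrier G \<Longrightarrow>
    word_prod G (v @ w) = word_prod G v \<otimes> word_prod G w"
  by (induction v) (auto simp: m_assoc)

lemma word_prod_inv_word:
  "set w \<subseteq> carrier G \<Longrightarrow> word_prod G (rev (map (\<lambda>a. inv a) w)) = inv (word_prod G w)"
proof (induction w)
  case (Cons a w)
  have "word_prod G (rev (map (\<lambda>a. inv a) w) @ [inv a])
      = word_prod G (rev (map (\<lambda>a. inv a) w)) \<otimes> inv a"
    using Cons.prems by (subst word_prod_append) auto
  then show ?case using Cons by (simp add: inv_mult_group)
qed simp

lemma inv_mult_cancel_left: "a \<in> carrier G \<Longrightarrow> c \<in> carrier G \<Longrightarrow> inv a \<otimes> (a \<otimes> c) = c"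
  by (simp flip: m_assoc)

lemma mult_inv_cancel_left: "a \<in> carrier G \<Longrightarrow> c \<in> carrier G \<Longrightarrow> a \<otimes> (inv a \<otimes> c) = c"
  by (simp flip: m_assoc)

lemma inv_mult_cancel_middle:
  "a \<in> carrier G \<Longrightarrow> b \<in> carrier G \<Longrightarrow> c \<in> carrier G \<Longrightarrow>
    inv (a \<otimes> b) \<otimes> (a \<otimes> c) = inv b \<otimes> c"
  by (simp add: inv_mult_group m_assoc inv_mult_cancel_left)

lemma letters_closed: "A \<subseteq> carrier G \<Longrightarrow> letters G A \<subseteq> carrier G"
  by (auto simp: letters_def)

lemma letters_inv: "A \<subseteq> carrier G \<Longrightarrow> a \<in> letters G A \<Longrightarrow> inv a \<in> letters G A"
  unfolding letters_def by auto

lemma finite_letters: "finite A \<Longrightarrow> finite (letters G A)"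
  by (simp add: letters_def)

lemma letters_inv_word:
  "A \<subseteq> carrier G \<Longrightarrow> set w \<subseteq> letters G A \<Longrightarrow>
    set (rev (map (\<lambda>a. inv a) w)) \<subseteq> letters G A"
  using letters_inv by auto

end

section \<open>Word length with respect to a finite generating set\<close>

locale generated_group = group G for G (structure) +
  fixes S :: "'a set"
  assumes gens_closed: "S \<subseteq> carrier G" and gens_finite: "finite S"
    and generates: "generate G S = carrier G"
begin

abbreviation wlen :: "'a \<Rightarrow> nat" where "wlen \<equiv> word_length G S"

lemma word_exists:
  assumes "g \<in> carrier G"
  shows "\<exists>w. set w \<subseteq> letters G S \<and> word_prod G w = g"
proof -
  have "g \<in> generate G S" using assms generates by simp
  then show ?thesis
  proof (induction rule: generate.induct)
    case one
    show ?case by (rule exI[of _ "[]"]) simp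
  next
    case (incl h)
    then show ?case using gens_closed by (intro exI[of _ "[h]"]) (auto simp: letters_def)
  next
    case (inv h)
    then show ?case using gens_closed by (intro exI[of _ "[inv h]"]) (auto simp: letters_def)
  next
    case (eng g h)
    then obtain v w where "set v \<subseteq> letters G S" "word_prod G v = g"
      "set w \<subseteq> letters G S" "word_prod G w = h" by blast
    then show ?case using letters_closed[OF gens_closed]
      by (intro exI[of _ "v @ w"]) (auto simp: word_prod_append)
  qed
qed

lemma geodesic_word:
  assumes "g \<in> carrier G"
  obtains w where "set w \<subseteq> letters G S" "length w = wlen g" "word_prod G w = g"
proof -
  have "\<exists>n w. set w \<subseteq> letters G S \<and> length w = n \<and> word_prod G w = g"
    using word_exists[OF assms] by blast
  then have "\<exists>w. set w \<subseteq> letters G S \<and> length w = wlen g \<and> word_prod G w = g"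
    unfolding word_length_def by (rule LeastI_ex)
  then show ?thesis using that by blast
qed

lemma wlen_word_prod_le: "set w \<subseteq> letters G S \<Longrightarrow> wlen (word_prod G w) \<le> length w"
  unfolding word_length_def by (rule Least_le) blast

lemma wlen_one [simp]: "wlen \<one> = 0"
  using wlen_word_prod_le[of "[]"] by simp

lemma wlen_mult_le:
  assumes "g \<in> carrier G" "h \<in> carrier G"
  shows "wlen (g \<otimes> h) \<le> wlen g + wlen h"
proof -
  obtain v where v: "set v \<subseteq> letters G S" "length v = wlen g" "word_prod G v = g"
    using geodesic_word[OF assms(1)] .
  obtain w where w: "set w \<subseteq> letters G S" "length w = wlen h" "word_prod G w = h"
    using geodesic_word[OF assms(2)] .
  have "wlen (word_prod G (v @ w)) \<le> length (v @ w)"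
    using v w by (intro wlen_word_prod_le) auto
  moreover have "word_prod G (v @ w) = g \<otimes> h"
    using v w letters_closed[OF gens_closed] by (subst word_prod_append) auto
  ultimately show ?thesis using v w by simp
qed

lemma wlen_inv_le:
  assumes "g \<in> carrier G"
  shows "wlen (inv g) \<le> wlen g"
proof -
  obtain v where v: "set v \<subseteq> letters G S" "length v = wlen g" "word_prod G v = g"
    using geodesic_word[OF assms(1)] .
  have "wlen (word_prod G (rev (map (\<lambda>a. inv a) v))) \<le> length (rev (map (\<lambda>a. inv a) v))"
    using v letters_inv_word[OF gens_closed] by (intro wlen_word_prod_le) auto
  moreover have "word_prod G (rev (map (\<lambda>a. inv a) v)) = inv g"
    using v letters_closed[OF gens_closed] by (subst word_prod_inv_word) auto
  ultimately show ?thesis using v by simp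
qed

lemma wlen_inv: "g \<in> carrier G \<Longrightarrow> wlen (inv g) = wlen g"
  using wlen_inv_le[of g] wlen_inv_le[of "inv g"] by simp

lemma wlen_word_prod_bound:
  assumes "set w \<subseteq> carrier G" "\<And>a. a \<in> set w \<Longrightarrow> wlen a \<le> M"
  shows "wlen (word_prod G w) \<le> M * length w"
  using assms
proof (induction w)
  case (Cons a w)
  have "wlen (a \<otimes> word_prod G w) \<le> wlen a + wlen (word_prod G w)"
    using Cons.prems by (intro wlen_mult_le) auto
  also have "\<dots> \<le> M + M * length w"
    using Cons.prems by (intro add_mono Cons.IH) auto
  finally show ?case by simp
qed simp

end

section \<open>Normal forms over a basis\<close>

locale based_group = group G for G (structure) +
  fixes A :: "'a set"
  assumes basis: "free_basis G A"
begin

lemma basis_closed: "A \<subseteq> carrier G"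
  and basis_disjoint: "A \<inter> (\<lambda>a. inv a) ` A = {}"
  and basis_bij: "bij_betw (word_prod G) (reduced_words G A) (carrier G)"
  using basis by (auto simp: free_basis_def)

abbreviation alph :: "'a set" where "alph \<equiv> letters G A"

lemma alph_closed: "alph \<subseteq> carrier G"
  using basis_closed by (rule letters_closed)

lemma alph_carrier [simp, dest]: "a \<in> alph \<Longrightarrow> a \<in> carrier G"
  using alph_closed by auto

lemma alph_inv [simp, intro]: "a \<in> alph \<Longrightarrow> inv a \<in> alph"
  using basis_closed by (rule letters_inv)

lemma basis_alph [simp, intro]: "a \<in> A \<Longrightarrow> a \<in> alph"
  by (simp add: letters_def)

lemma basis_inv_notin: "a \<in> A \<Longrightarrow> b \<in> A \<Longrightarrow> a \<noteq> inv b"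
  using basis_disjoint by auto

abbreviation redw :: "'a list set" where "redw \<equiv> reduced_words G A"

definition nf :: "'a \<Rightarrow> 'a list"
  where "nf = the_inv_into redw (word_prod G)"

lemma nf_reduced [simp]: "g \<in> carrier G \<Longrightarrow> nf g \<in> redw"
  and word_prod_nf [simp]: "g \<in> carrier G \<Longrightarrow> word_prod G (nf g) = g"
  and nf_word_prod: "w \<in> redw \<Longrightarrow> nf (word_prod G w) = w"
  using basis_bij unfolding nf_def bij_betw_def
  by (auto intro: the_inv_into_into the_inv_into_f_f f_the_inv_into_f)

lemma nf_alph: "g \<in> carrier G \<Longrightarrow> set (nf g) \<subseteq> alph"
  using nf_reduced by (simp add: reduced_words_def del: nf_reduced)

lemma redw_carrier: "w \<in> redw \<Longrightarrow> set w \<subseteq> carrier G"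
  using alph_closed by (auto simp: reduced_words_def)

lemma redw_appendD: "v @ w \<in> redw \<Longrightarrow> v \<in> redw \<and> w \<in> redw"
  by (auto simp: reduced_words_def successively_append_iff)

lemma nf_one [simp]: "nf \<one> = []"
  using nf_word_prod[of "[]"] by (simp add: reduced_words_def)

lemma redw_inv_word:
  assumes "w \<in> redw"
  shows "rev (map (\<lambda>a. inv a) w) \<in> redw"
proof -
  have "successively (\<lambda>a b. b \<noteq> inv a) w" "set w \<subseteq> alph"
    using assms by (auto simp: reduced_words_def)
  then have "successively (\<lambda>a b. inv a \<noteq> inv (inv b)) w"
    by (elim successively_mono) auto
  then show ?thesis
    using \<open>set w \<subseteq> alph\<close> unfolding reduced_words_def by (auto simp: successively_map)
qed

lemma nf_inv: "g \<in> carrier G \<Longrightarrow> nf (inv g) = rev (map (\<lambda>a. inv a) (nf g))"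
  using nf_word_prod[OF redw_inv_word[OF nf_reduced[of g]]] word_prod_inv_word[of "nf g"]
    redw_carrier[OF nf_reduced[of g]] by simp

text \<open>In each case the claimed word is reduced and has product \<open>a \<otimes> g\<close>,
  and a reduced word is determined by its product. Length estimates, the action on rays and the
  homomorphism \<open>extension\<close> rest on this rule.\<close>

lemma nf_mult_letter:
  assumes a: "a \<in> alph" and g: "g \<in> carrier G"
  shows "nf (a \<otimes> g) = (if nf g \<noteq> [] \<and> hd (nf g) = inv a then tl (nf g) else a # nf g)"
proof (cases "nf g \<noteq> [] \<and> hd (nf g) = inv a")
  case True
  then obtain w where w: "nf g = inv a # w" by (cases "nf g") auto
  then have wr: "w \<in> redw" using nf_reduced[OF g] redw_appendD[of "[inv a]" w] by simp
  have "g = inv a \<otimes> word_prod G w" using word_prod_nf[OF g] w by simp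
  then have "a \<otimes> g = word_prod G w"
    using a redw_carrier[OF wr] by (simp add: mult_inv_cancel_left)
  then show ?thesis using w nf_word_prod[OF wr] by simp
next
  case False
  have "a # nf g \<in> redw"
    using a nf_reduced[OF g] False unfolding reduced_words_def
    by (auto simp: successively_Cons)
  from nf_word_prod[OF this] show ?thesis using False g by auto
qed

lemma nf_letter: "a \<in> alph \<Longrightarrow> nf a = [a]"
  using nf_mult_letter[of a \<one>] by simp

lemma length_nf_word_prod_le: "set w \<subseteq> alph \<Longrightarrow> length (nf (word_prod G w)) \<le> length w"
proof (induction w)
  case (Cons a w)
  then show ?case
    using alph_closed by (auto simp: nf_mult_letter[of a "word_prod G w"])
qed simp

lemma word_length_eq:
  assumes "g \<in> carrier G"
  shows "word_length G A g = length (nf g)"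
  unfolding word_length_def
proof (rule Least_equality)
  show "\<exists>w. set w \<subseteq> alph \<and> length w = length (nf g) \<and> word_prod G w = g"
    using assms nf_alph by (intro exI[of _ "nf g"]) auto
next
  fix n assume "\<exists>w. set w \<subseteq> alph \<and> length w = n \<and> word_prod G w = g"
  then show "length (nf g) \<le> n" using length_nf_word_prod_le by auto
qed

text \<open>The letters occurring in the normal forms of a finite generating set suffice to write
  every element, hence they exhaust the basis.\<close>
lemma finite_basis:
  assumes "generated_group G S"
  shows "finite A"
proof -
  interpret S: generated_group G S by fact
  define T where "T = (\<Union>s\<in>letters G S. set (nf s))"
  have T: "s \<in> letters G S \<Longrightarrow> set (nf s) \<subseteq> T" for s by (auto simp: T_def)
  have "finite T" unfolding T_def using S.gens_finite by (simp add: finite_letters)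
  have sub: "set (nf (word_prod G v \<otimes> h)) \<subseteq> set v \<union> set (nf h)"
    if "set v \<subseteq> alph" "h \<in> carrier G" for v h
    using that
  proof (induction v)
    case (Cons a v)
    have "set v \<subseteq> carrier G" using Cons.prems alph_closed by auto
    then have "word_prod G (a # v) \<otimes> h = a \<otimes> (word_prod G v \<otimes> h)"
      using Cons.prems by (simp add: m_assoc)
    then show ?case
      using Cons \<open>set v \<subseteq> carrier G\<close> nf_mult_letter[of a "word_prod G v \<otimes> h"]
      by (auto dest: list.set_sel(2))
  qed simp
  have "set (nf (word_prod G w)) \<subseteq> T" if "set w \<subseteq> letters G S" for w
    using that
  proof (induction w)
    case (Cons s w)
    have "s \<in> carrier G" "set w \<subseteq> carrier G"
      using Cons.prems letters_closed[OF S.gens_closed] by auto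
    then have "set (nf (s \<otimes> word_prod G w)) \<subseteq> set (nf s) \<union> set (nf (word_prod G w))"
      using sub[OF nf_alph, of s "word_prod G w"] by simp
    then show ?case using T[of s] Cons by auto
  qed simp
  moreover have "a \<in> set (nf a)" "\<exists>w. set w \<subseteq> letters G S \<and> word_prod G w = a" if "a \<in> A" for a
    using that nf_letter[of a] S.word_exists[of a] by auto
  ultimately have "A \<subseteq> T" by blast
  then show ?thesis using \<open>finite T\<close> finite_subset by blast
qed

section \<open>Longest common prefixes and Gromov products in the tree of a basis\<close>

lemma common_prefix:
  obtains p u v where "nf g = p @ u" "nf h = p @ v" "u = [] \<or> v = [] \<or> hd u \<noteq> hd v"
proof -
  have "\<exists>p u v. x = p @ u \<and> y = p @ v \<and> (u = [] \<or> v = [] \<or> hd u \<noteq> hd v)" for x y :: "'a list"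
  proof (induction x arbitrary: y)
    case (Cons a x)
    show ?case
    proof (cases "y \<noteq> [] \<and> hd y = a")
      case True
      then obtain y' where y: "y = a # y'" by (cases y) auto
      obtain p u v where "x = p @ u" "y' = p @ v" "u = [] \<or> v = [] \<or> hd u \<noteq> hd v"
        using Cons.IH by blast
      then show ?thesis using y by (intro exI[of _ "a # p"] exI[of _ u] exI[of _ v]) auto
    next
      case False
      then show ?thesis
        by (intro exI[of _ "[]"] exI[of _ "a # x"] exI[of _ y]) auto
    qed
  qed simp
  then show ?thesis using that by blast
qed

text \<open>The disjunction in \<open>eq\<close> makes \<open>p\<close> the longest common prefix.
  It cancels in \<open>inv g \<otimes> h\<close>, and nothing more cancels where the inverse of
  \<open>u\<close> meets \<open>v\<close>. The result labels the geodesic from \<open>g\<close> to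
  \<open>h\<close>, which passes through the vertex of \<open>p\<close>.\<close>

lemma nf_diff_common_prefix:
  assumes g: "g \<in> carrier G" and h: "h \<in> carrier G"
    and eq: "nf g = p @ u" "nf h = p @ v" "u = [] \<or> v = [] \<or> hd u \<noteq> hd v"
  shows "nf (inv g \<otimes> h) = rev (map (\<lambda>a. inv a) u) @ v"
proof -
  have r: "p \<in> redw" "u \<in> redw" "v \<in> redw"
    using nf_reduced g h eq redw_appendD by metis+
  have c: "set p \<subseteq> carrier G" "set u \<subseteq> carrier G" "set v \<subseteq> carrier G"
    using r redw_carrier by auto
  let ?i = "rev (map (\<lambda>a. inv a) u)"
  have "g = word_prod G p \<otimes> word_prod G u" "h = word_prod G p \<otimes> word_prod G v"
    using eq word_prod_nf[OF g] word_prod_nf[OF h] c by (metis word_prod_append)+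
  then have "inv g \<otimes> h = inv (word_prod G u) \<otimes> word_prod G v"
    using c by (simp add: inv_mult_cancel_middle)
  also have "\<dots> = word_prod G (?i @ v)"
    using c by (subst word_prod_append) (auto simp: word_prod_inv_word)
  finally have *: "inv g \<otimes> h = word_prod G (?i @ v)" .
  have "?i \<in> redw" using r redw_inv_word by blast
  moreover have "?i = [] \<or> v = [] \<or> hd v \<noteq> inv (last ?i)"
  proof (cases u)
    case (Cons a u')
    then show ?thesis using eq(3) c by auto
  qed simp
  ultimately have "?i @ v \<in> redw"
    using r(3) unfolding reduced_words_def by (auto simp: successively_append_iff)
  then show ?thesis using * nf_word_prod by simp
qed

lemma gromov_product_common_prefix:
  assumes "g \<in> carrier G" "h \<in> carrier G"
    and "nf g = p @ u" "nf h = p @ v" "u = [] \<or> v = [] \<or> hd u \<noteq> hd v"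
  shows "gromov_product G A g h = real (length p)"
  unfolding gromov_product_def
  using assms nf_diff_common_prefix[OF assms] by (simp add: word_length_eq)

text \<open>Turns thresholds on the Gromov product into equality of lists. The length bounds matter
  because \<open>take\<close> silently returns short lists unchanged.\<close>

lemma le_gromov_product_iff:
  assumes "g \<in> carrier G" "h \<in> carrier G"
  shows "real n \<le> gromov_product G A g h \<longleftrightarrow>
    n \<le> length (nf g) \<and> n \<le> length (nf h) \<and> take n (nf g) = take n (nf h)"
proof -
  obtain p u v where eq: "nf g = p @ u" "nf h = p @ v" "u = [] \<or> v = [] \<or> hd u \<noteq> hd v"
    by (rule common_prefix)
  have "n \<le> length p" if "n \<le> length (nf g)" "n \<le> length (nf h)" "take n (nf g) = take n (nf h)"
  proof (rule ccontr)
    assume "\<not> n \<le> length p"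
    then have "length p < n" by simp
    then have "u \<noteq> []" "v \<noteq> []" using that(1,2) eq by auto
    moreover have "nf g ! length p = nf h ! length p"
      using that(3) \<open>length p < n\<close> by (metis nth_take)
    ultimately show False using eq by (simp add: nth_append hd_conv_nth)
  qed
  then show ?thesis using gromov_product_common_prefix[OF assms eq] eq by auto
qed

end

section \<open>Comparing Gromov products\<close>

context based_group
begin

text \<open>The partial products of \<open>w\<close> form a path in the tree with steps of length at
  most \<open>K\<close>. If \<open>p\<close> is not yet a prefix before the last step, then this
  step runs across the vertex of \<open>p\<close>, and \<open>v\<close> is only a part of it; so the
  end of the path is near \<open>p\<close>.\<close>

lemma prefix_near_path:
  assumes "set w \<subseteq> carrier G" "\<And>s. s \<in> set w \<Longrightarrow> length (nf s) \<le> K"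
    and "nf (word_prod G w) = p @ v"
  shows "\<exists>w1 w2. w = w1 @ w2 \<and> length (nf (inv (word_prod G w1) \<otimes> word_prod G p)) \<le> K"
  using assms
proof (induction w arbitrary: v rule: rev_induct)
  case Nil
  then show ?case by simp
next
  case (snoc s w)
  let ?h = "word_prod G w" and ?g = "word_prod G (w @ [s])"
  have c: "set w \<subseteq> carrier G" "s \<in> carrier G" and K: "length (nf s) \<le> K" using snoc.prems by auto
  have g: "?g = ?h \<otimes> s" using c by (simp add: word_prod_append)
  show ?case
  proof (cases "\<exists>v'. nf ?h = p @ v'")
    case True
    then obtain w1 w2 where "w = w1 @ w2"
      "length (nf (inv (word_prod G w1) \<otimes> word_prod G p)) \<le> K"
      using snoc.IH c snoc.prems by auto
    then show ?thesis by (intro exI[of _ w1] exI[of _ "w2 @ [s]"]) simp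
  next
    case False
    obtain q x y where q: "nf ?h = q @ x" "nf ?g = q @ y" "x = [] \<or> y = [] \<or> hd x \<noteq> hd y"
      by (rule common_prefix)
    have "nf (inv ?h \<otimes> ?g) = rev (map (\<lambda>a. inv a) x) @ y"
      using q c by (intro nf_diff_common_prefix) auto
    moreover have "inv ?h \<otimes> ?g = s" using c g by (simp add: inv_mult_cancel_left)
    ultimately have "length y \<le> K" using K by simp
    \<comment> \<open>\<open>q\<close> cannot extend \<open>p\<close>, otherwise \<open>p\<close>
      would be a prefix of \<open>nf ?h\<close>. Hence \<open>p\<close> extends \<open>q\<close>,
      and \<open>v\<close> is a suffix of \<open>y\<close>.\<close>
    obtain p' where p': "p = q @ p'" "y = p' @ v"
      using q False snoc.prems(3) by (auto simp: append_eq_append_conv2)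
    have nfg: "nf ?g = p @ v" by fact
    have "?g \<in> carrier G" using c by auto
    then have "p @ v \<in> redw" and gpv: "?g = word_prod G (p @ v)"
      using nfg nf_reduced[of ?g] word_prod_nf[of ?g] by auto
    then have r: "p \<in> redw" "v \<in> redw" using redw_appendD by blast+
    then have pv: "set p \<subseteq> carrier G" "set v \<subseteq> carrier G" using redw_carrier by auto
    have "inv ?g \<otimes> word_prod G p = inv (word_prod G v)"
      using gpv pv by (simp add: word_prod_append inv_mult_group m_assoc)
    then have "length (nf (inv ?g \<otimes> word_prod G p)) = length v"
      using r pv by (simp add: nf_inv nf_word_prod)
    then show ?thesis
      using \<open>length y \<le> K\<close> p' by (intro exI[of _ "w @ [s]"] exI[of _ "[]"]) simp
  qed
qed

context
  fixes S K M
  assumes S: "generated_group G S"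
    and K: "\<And>s. s \<in> letters G S \<Longrightarrow> length (nf s) \<le> K"
    and M: "\<And>a. a \<in> alph \<Longrightarrow> word_length G S a \<le> M"
begin

interpretation S: generated_group G S by (rule S)

lemma wlen_le_length: "g \<in> carrier G \<Longrightarrow> S.wlen g \<le> M * length (nf g)"
  using S.wlen_word_prod_bound[of "nf g" M] M nf_alph[of g] redw_carrier[OF nf_reduced, of g]
  by auto

lemma length_le_wlen:
  assumes "g \<in> carrier G"
  shows "length (nf g) \<le> K * S.wlen g"
proof -
  obtain w where w: "set w \<subseteq> letters G S" "length w = S.wlen g" "word_prod G w = g"
    using S.geodesic_word[OF assms] .
  have "length (nf (word_prod G w)) \<le> K * length w"
    using w(1)
  proof (induction w)
    case (Cons s w)
    have c: "s \<in> carrier G" "set w \<subseteq> carrier G"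
      using Cons.prems letters_closed[OF S.gens_closed] by auto
    have "s \<otimes> word_prod G w = word_prod G (nf s @ nf (word_prod G w))"
      using c redw_carrier by (subst word_prod_append) auto
    then have "length (nf (s \<otimes> word_prod G w)) \<le> length (nf s @ nf (word_prod G w))"
      using length_nf_word_prod_le[of "nf s @ nf (word_prod G w)"] nf_alph c by auto
    also have "\<dots> \<le> K + K * length w"
      using Cons K[of s] by simp
    finally show ?case by simp
  qed simp
  then show ?thesis using w by simp
qed

text \<open>A geodesic \<open>S\<close>-word for \<open>g\<close> has a vertex \<open>q\<close>
  within \<open>A\<close>-distance \<open>K\<close> of \<open>p\<close>, hence within
  \<open>S\<close>-distance \<open>M * K\<close>. Cutting the geodesic there and correcting by
  \<open>d\<close> gives both factors; the correction occurs in each of them, which explains the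
  2.\<close>

lemma wlen_almost_additive:
  assumes g: "g \<in> carrier G" and nfg: "nf g = p @ v"
  shows "S.wlen (word_prod G p) + S.wlen (word_prod G v) \<le> S.wlen g + 2 * M * K"
proof -
  obtain w where w: "set w \<subseteq> letters G S" "length w = S.wlen g" "word_prod G w = g"
    using S.geodesic_word[OF g] .
  have wc: "set w \<subseteq> carrier G" using w letters_closed[OF S.gens_closed] by auto
  obtain w1 w2 where w12: "w = w1 @ w2" "length (nf (inv (word_prod G w1) \<otimes> word_prod G p)) \<le> K"
    using prefix_near_path[OF wc, of K p v] K w nfg by auto
  define q q' where "q = word_prod G w1" and "q' = word_prod G w2"
  define d where "d = inv q \<otimes> word_prod G p"
  have pv: "set p \<subseteq> carrier G" "set v \<subseteq> carrier G"
    using redw_carrier[OF nf_reduced[OF g]] nfg by auto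
  have c: "q \<in> carrier G" "q' \<in> carrier G" "d \<in> carrier G"
    using w12 wc pv by (auto simp: q_def q'_def d_def)
  have gq: "g = q \<otimes> q'" using w w12 wc by (auto simp: q_def q'_def word_prod_append)
  have p: "word_prod G p = q \<otimes> d" using c pv by (simp add: d_def mult_inv_cancel_left)
  have "g = word_prod G p \<otimes> word_prod G v"
    using word_prod_nf[OF g] nfg pv by (simp add: word_prod_append)
  then have "word_prod G v = inv (word_prod G p) \<otimes> g"
    using pv by (simp add: inv_mult_cancel_left)
  then have v: "word_prod G v = inv d \<otimes> q'"
    using gq p c by (simp add: inv_mult_cancel_middle)
  have "S.wlen d \<le> M * length (nf d)" using wlen_le_length c by blast
  also have "\<dots> \<le> M * K" using w12(2) by (simp add: d_def q_def)
  finally have "S.wlen d \<le> M * K" .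
  moreover have "S.wlen q \<le> length w1" "S.wlen q' \<le> length w2"
    unfolding q_def q'_def using w(1) w12(1) by (auto intro!: S.wlen_word_prod_le)
  ultimately show ?thesis
    using S.wlen_mult_le[of q d] S.wlen_mult_le[of "inv d" q'] c p v w(2) w12(1)
    by (simp add: S.wlen_inv)
qed

text \<open>All three lengths in the Gromov product split at the branch vertex, and the
  contributions of \<open>u\<close> and \<open>v\<close> cancel. The lower bound uses almost
  additivity for \<open>g\<close> and \<open>h\<close>, the upper bound only for
  \<open>inv g \<otimes> h\<close>; after halving, the errors are \<open>2 * M * K\<close> and
  \<open>M * K\<close>.\<close>

lemma gromov_product_near_common_prefix:
  assumes g: "g \<in> carrier G" and h: "h \<in> carrier G"
    and eq: "nf g = p @ u" "nf h = p @ v" "u = [] \<or> v = [] \<or> hd u \<noteq> hd v"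
  shows "real (S.wlen (word_prod G p)) \<le> gromov_product G S g h + 2 * M * K"
    and "gromov_product G S g h \<le> real (S.wlen (word_prod G p)) + M * K"
proof -
  have r: "p @ u \<in> redw" "p @ v \<in> redw" using nf_reduced g h eq by metis+
  then have c: "set p \<subseteq> carrier G" "set u \<subseteq> carrier G" "set v \<subseteq> carrier G"
    using redw_carrier[of "p @ u"] redw_carrier[of "p @ v"] by auto
  have gh: "g = word_prod G p \<otimes> word_prod G u" "h = word_prod G p \<otimes> word_prod G v"
    using eq word_prod_nf[OF g] word_prod_nf[OF h] c by (metis word_prod_append)+
  have igh: "inv g \<otimes> h = inv (word_prod G u) \<otimes> word_prod G v"
    unfolding gh using c by (simp add: inv_mult_cancel_middle)
  have g1: "S.wlen (word_prod G p) + S.wlen (word_prod G u) \<le> S.wlen g + 2 * M * K"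
    by (rule wlen_almost_additive[OF g eq(1)])
  have h1: "S.wlen (word_prod G p) + S.wlen (word_prod G v) \<le> S.wlen h + 2 * M * K"
    by (rule wlen_almost_additive[OF h eq(2)])
  have "S.wlen (word_prod G (rev (map (\<lambda>a. inv a) u))) + S.wlen (word_prod G v)
      \<le> S.wlen (inv g \<otimes> h) + 2 * M * K"
    using g h by (intro wlen_almost_additive nf_diff_common_prefix[OF g h eq]) auto
  then have gh1: "S.wlen (word_prod G u) + S.wlen (word_prod G v) \<le> S.wlen (inv g \<otimes> h) + 2 * M * K"
    using c by (simp add: word_prod_inv_word S.wlen_inv)
  have g2: "S.wlen g \<le> S.wlen (word_prod G p) + S.wlen (word_prod G u)"
    unfolding gh using c by (intro S.wlen_mult_le) auto
  have h2: "S.wlen h \<le> S.wlen (word_prod G p) + S.wlen (word_prod G v)"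
    unfolding gh using c by (intro S.wlen_mult_le) auto
  have gh2: "S.wlen (inv g \<otimes> h) \<le> S.wlen (word_prod G u) + S.wlen (word_prod G v)"
    unfolding igh using S.wlen_mult_le[of "inv (word_prod G u)" "word_prod G v"] c
    by (simp add: S.wlen_inv)
  show "real (S.wlen (word_prod G p)) \<le> gromov_product G S g h + 2 * M * K"
    using g1[folded of_nat_le_iff[where 'a=real]] h1[folded of_nat_le_iff[where 'a=real]]
      gh2[folded of_nat_le_iff[where 'a=real]]
    unfolding gromov_product_def by (simp add: field_simps)
  show "gromov_product G S g h \<le> real (S.wlen (word_prod G p)) + M * K"
    using g2[folded of_nat_le_iff[where 'a=real]] h2[folded of_nat_le_iff[where 'a=real]]
      gh1[folded of_nat_le_iff[where 'a=real]]
    unfolding gromov_product_def by (simp add: field_simps)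
qed

end

text \<open>Over \<open>A\<close> the product is the length of the common prefix \<open>p\<close>,
  over \<open>S\<close> it is close to the \<open>S\<close>-length of \<open>p\<close>, and these
  lengths bound each other linearly. One constant serves as factor and as summand in both
  directions.\<close>

lemma gromov_product_comparison:
  assumes "generated_group G S"
  obtains M :: nat where "M \<ge> 1"
    "\<And>g h. g \<in> carrier G \<Longrightarrow> h \<in> carrier G \<Longrightarrow>
      gromov_product G A g h \<le> M * gromov_product G S g h + M"
    "\<And>g h. g \<in> carrier G \<Longrightarrow> h \<in> carrier G \<Longrightarrow>
      gromov_product G S g h \<le> M * gromov_product G A g h + M"
proof -
  interpret S: generated_group G S by fact
  have "finite (letters G S)" using S.gens_finite by (rule finite_letters)
  then obtain K where K: "\<And>s. s \<in> letters G S \<Longrightarrow> length (nf s) \<le> K"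
    using finite_nat_set_iff_bounded_le[of "(\<lambda>s. length (nf s)) ` letters G S"] by auto
  have "finite alph" using finite_basis[OF assms] by (rule finite_letters)
  then obtain L where L: "\<And>a. a \<in> alph \<Longrightarrow> S.wlen a \<le> L"
    using finite_nat_set_iff_bounded_le[of "S.wlen ` alph"] by auto
  \<comment> \<open>\<open>K\<close> and \<open>L\<close> are the factors of the two estimates
    below, the two products their additive errors, and the 1 makes \<open>M\<close>
    positive.\<close>
  define M where "M = 1 + K + L + K * (2 * L * K) + L * K"
  have "gromov_product G A g h \<le> M * gromov_product G S g h + M \<and>
      gromov_product G S g h \<le> M * gromov_product G A g h + M"
    if g: "g \<in> carrier G" and h: "h \<in> carrier G" for g h
  proof -
    obtain p u v where eq: "nf g = p @ u" "nf h = p @ v" "u = [] \<or> v = [] \<or> hd u \<noteq> hd v"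
      by (rule common_prefix)
    have "p @ u \<in> redw" using nf_reduced g eq by metis
    then have "p \<in> redw" using redw_appendD by blast
    then have pc: "word_prod G p \<in> carrier G" and pn: "nf (word_prod G p) = p"
      using redw_carrier nf_word_prod by auto
    have 0: "S.wlen (inv g \<otimes> h) \<le> S.wlen g + S.wlen h"
      using S.wlen_mult_le[of "inv g" h] g h by (simp add: S.wlen_inv)
    \<comment> \<open>This sign is what allows the factor \<open>K\<close> to be enlarged to
      \<open>M\<close>.\<close>
    have nonneg: "gromov_product G S g h \<ge> 0"
      using 0[folded of_nat_le_iff[where 'a=real]] by (simp add: gromov_product_def)
    have A: "gromov_product G A g h = length p" by (rule gromov_product_common_prefix[OF g h eq])
    have "real (length p) \<le> real (K * S.wlen (word_prod G p))"
      using length_le_wlen[OF assms K L pc] pn by (simp only: of_nat_le_iff)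
    also have "\<dots> \<le> K * (gromov_product G S g h + 2 * L * K)"
      using gromov_product_near_common_prefix(1)[OF assms K L g h eq]
      by (simp add: mult_left_mono)
    also have "\<dots> = K * gromov_product G S g h + real (K * (2 * L * K))"
      by (simp add: algebra_simps)
    also have "\<dots> \<le> M * gromov_product G S g h + M"
      using nonneg by (intro add_mono mult_right_mono) (auto simp: M_def)
    finally have 1: "gromov_product G A g h \<le> M * gromov_product G S g h + M" using A by simp
    have "gromov_product G S g h \<le> real (S.wlen (word_prod G p)) + L * K"
      by (rule gromov_product_near_common_prefix(2)[OF assms K L g h eq])
    also have "\<dots> \<le> real (L * length p) + real (L * K)"
      using wlen_le_length[OF assms K L pc] pn by (metis add_right_mono of_nat_le_iff of_nat_mult)
    also have "\<dots> \<le> M * real (length p) + M"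
      unfolding of_nat_mult by (intro add_mono mult_right_mono) (auto simp: M_def)
    finally show ?thesis using 1 A by simp
  qed
  then show ?thesis using that[of M] by (simp add: M_def)
qed

text \<open>Lets a second basis take the role of \<open>S\<close> in the comparison of Gromov
  products.\<close>

lemma generated_group_basis:
  assumes "finite A"
  shows "generated_group G A"
proof
  show "A \<subseteq> carrier G" "finite A" using basis_closed assms by auto
  have *: "word_prod G w \<in> generate G A" if "set w \<subseteq> alph" for w
    using that
  proof (induction w)
    case (Cons a w)
    then have "a \<in> generate G A"
      by (auto simp: letters_def intro: generate.incl generate.inv)
    then show ?case using Cons by (auto intro: generate.eng)
  qed (simp add: generate.one)
  have "carrier G \<subseteq> generate G A"
    using * nf_alph word_prod_nf by (metis subsetI)
  then show "generate G A = carrier G" using generate_incl[OF basis_closed] by auto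
qed

end

section \<open>Boundary points as rays\<close>

lemma filterlim_at_top_if_le_linear:
  fixes f g :: "'a \<Rightarrow> real"
  assumes "filterlim f at_top F" "m \<ge> 1" "\<And>x. f x \<le> m * g x + m"
  shows "filterlim g at_top F"
  unfolding filterlim_at_top
proof
  fix Z
  have "\<forall>\<^sub>F x in F. m * Z + m \<le> f x"
    using assms(1) by (simp add: filterlim_at_top)
  then show "\<forall>\<^sub>F x in F. Z \<le> g x"
  proof eventually_elim
    case (elim x)
    then have "m * Z \<le> m * g x" using assms(3)[of x] by linarith
    then show ?case using assms(2) by simp
  qed
qed

lemma filterlim_at_top_of_nat:
  fixes f :: "'a \<Rightarrow> real"
  shows "filterlim f at_top F \<longleftrightarrow> (\<forall>n::nat. \<forall>\<^sub>F x in F. real n \<le> f x)"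
proof
  assume *: "\<forall>n::nat. \<forall>\<^sub>F x in F. real n \<le> f x"
  show "filterlim f at_top F"
    unfolding filterlim_at_top
  proof
    fix Z
    obtain n where "Z \<le> real n" using real_arch_simple by blast
    with *[rule_format, of n] show "\<forall>\<^sub>F x in F. Z \<le> f x"
      by (elim eventually_mono) linarith
  qed
qed (simp add: filterlim_at_top)

context based_group
begin

lemma gromov_close_iff:
  assumes S: "generated_group G S" and st: "range s \<subseteq> carrier G" "range t \<subseteq> carrier G"
  shows "gromov_close G S s t \<longleftrightarrow> gromov_close G A s t"
proof -
  obtain M :: nat where M: "M \<ge> 1"
    "\<And>g h. g \<in> carrier G \<Longrightarrow> h \<in> carrier G \<Longrightarrow>
      gromov_product G A g h \<le> M * gromov_product G S g h + M"
    "\<And>g h. g \<in> carrier G \<Longrightarrow> h \<in> carrier G \<Longrightarrow>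
      gromov_product G S g h \<le> M * gromov_product G A g h + M"
    using gromov_product_comparison[OF S] by blast
  have "s i \<in> carrier G" "t i \<in> carrier G" for i using st by auto
  then show ?thesis
    unfolding gromov_close_def using M
    by (auto elim!: filterlim_at_top_if_le_linear[where m = "real M"])
qed

lemma gromov_close_nf:
  assumes st: "range s \<subseteq> carrier G" "range t \<subseteq> carrier G"
  shows "gromov_close G A s t \<longleftrightarrow> (\<forall>n. \<exists>N. \<forall>i\<ge>N. \<forall>j\<ge>N.
    n \<le> length (nf (s i)) \<and> n \<le> length (nf (t j)) \<and> take n (nf (s i)) = take n (nf (t j)))"
proof -
  have "s i \<in> carrier G" "t i \<in> carrier G" for i using st by auto
  then show ?thesis
    unfolding gromov_close_def filterlim_at_top_of_nat eventually_prod_sequentially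
    by (simp add: le_gromov_product_iff) meson
qed

text \<open>Convergence in the tree to the end of \<open>r\<close>. As the right-hand list has
  length \<open>n\<close>, the normal forms are forced to become long; that \<open>r\<close> is
  reduced follows (\<open>tends_ray\<close>).\<close>

definition tends :: "(nat \<Rightarrow> 'a) \<Rightarrow> (nat \<Rightarrow> 'a) \<Rightarrow> bool"
  where "tends s r \<longleftrightarrow> range s \<subseteq> carrier G \<and>
    (\<forall>n. \<forall>\<^sub>F i in sequentially. take n (nf (s i)) = map r [0..<n])"

definition ray :: "(nat \<Rightarrow> 'a) \<Rightarrow> bool"
  where "ray r \<longleftrightarrow> range r \<subseteq> alph \<and> (\<forall>i. r (Suc i) \<noteq> inv (r i))"

text \<open>A boundary point as a class of sequences. By \<open>boundary_point_eq\<close> the class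
  is the same for every finite generating set, so rays over different bases can be compared through
  it.\<close>

definition ray_end :: "(nat \<Rightarrow> 'a) \<Rightarrow> (nat \<Rightarrow> 'a) set"
  where "ray_end r = {s. tends s r}"

abbreviation ray_prefix :: "(nat \<Rightarrow> 'a) \<Rightarrow> nat \<Rightarrow> 'a"
  where "ray_prefix r n \<equiv> word_prod G (map r [0..<n])"

lemma tends_carrier: "tends s r \<Longrightarrow> range s \<subseteq> carrier G"
  by (simp add: tends_def)

lemma tendsD: "tends s r \<Longrightarrow> \<exists>N. \<forall>i\<ge>N. take n (nf (s i)) = map r [0..<n]"
  unfolding tends_def eventually_sequentially by blast

lemma take_eq_map_length: "take n w = map r [0..<n] \<Longrightarrow> n \<le> length w"
  by (metis diff_zero length_map length_take length_upt min.absorb_iff2 min_def nat_le_linear)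

lemma tends_close:
  assumes "tends s r" "tends t r"
  shows "gromov_close G A s t"
  unfolding gromov_close_nf[OF tends_carrier[OF assms(1)] tends_carrier[OF assms(2)]]
proof
  fix n
  obtain N1 where "\<And>i. i \<ge> N1 \<Longrightarrow> take n (nf (s i)) = map r [0..<n]" using tendsD[OF assms(1), of n] by blast
  moreover obtain N2 where "\<And>i. i \<ge> N2 \<Longrightarrow> take n (nf (t i)) = map r [0..<n]"
    using tendsD[OF assms(2), of n] by blast
  ultimately show "\<exists>N. \<forall>i\<ge>N. \<forall>j\<ge>N. n \<le> length (nf (s i)) \<and> n \<le> length (nf (t j)) \<and>
      take n (nf (s i)) = take n (nf (t j))"
    by (intro exI[of _ "max N1 N2"]) (auto intro: take_eq_map_length)
qed

lemma tends_unique: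
  assumes s: "tends s r" and t: "tends t r'" and close: "gromov_close G A s t"
  shows "r = r'"
proof
  fix k
  obtain N1 where N1: "\<And>i. i \<ge> N1 \<Longrightarrow> take (Suc k) (nf (s i)) = map r [0..<Suc k]"
    using tendsD[OF s, of "Suc k"] by blast
  obtain N2 where N2: "\<And>i. i \<ge> N2 \<Longrightarrow> take (Suc k) (nf (t i)) = map r' [0..<Suc k]"
    using tendsD[OF t, of "Suc k"] by blast
  obtain N where N: "\<And>i j. i \<ge> N \<Longrightarrow> j \<ge> N \<Longrightarrow> take (Suc k) (nf (s i)) = take (Suc k) (nf (t j))"
    using close unfolding gromov_close_nf[OF tends_carrier[OF s] tends_carrier[OF t]] by meson
  let ?n = "max N (max N1 N2)"
  have "map r [0..<Suc k] = map r' [0..<Suc k]"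
    using N1[of ?n] N2[of ?n] N[of ?n ?n] by simp
  then show "r k = r' k" by simp
qed

lemma tends_if_close:
  assumes s: "tends s r" and t: "range t \<subseteq> carrier G" and close: "gromov_close G A s t"
  shows "tends t r"
  unfolding tends_def
proof (intro conjI allI t)
  fix n
  obtain N1 where N1: "\<And>i. i \<ge> N1 \<Longrightarrow> take n (nf (s i)) = map r [0..<n]"
    using tendsD[OF s, of n] by blast
  obtain N where N: "\<And>i j. i \<ge> N \<Longrightarrow> j \<ge> N \<Longrightarrow> take n (nf (s i)) = take n (nf (t j))"
    using close unfolding gromov_close_nf[OF tends_carrier[OF s] t] by meson
  have "take n (nf (t j)) = map r [0..<n]" if "j \<ge> N" for j
    using N1[of "max N N1"] N[of "max N N1" j] that by simp
  then show "\<forall>\<^sub>F i in sequentially. take n (nf (t i)) = map r [0..<n]"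
    unfolding eventually_sequentially by blast
qed

lemma converges_tends:
  assumes "converges_to_infinity G A s"
  shows "\<exists>r. tends s r"
proof -
  have s: "range s \<subseteq> carrier G" and "gromov_close G A s s"
    using assms by (auto simp: converges_to_infinity_def)
  then have "\<forall>n. \<exists>N. \<forall>i\<ge>N. \<forall>j\<ge>N. n \<le> length (nf (s i)) \<and> take n (nf (s i)) = take n (nf (s j))"
    unfolding gromov_close_nf[OF s s] by meson
  then obtain N where N: "\<And>n i j. i \<ge> N n \<Longrightarrow> j \<ge> N n \<Longrightarrow>
      n \<le> length (nf (s i)) \<and> take n (nf (s i)) = take n (nf (s j))"
    by metis
  \<comment> \<open>From index \<open>N (Suc k)\<close> on the first \<open>Suc k\<close> letters no
    longer change, so letter \<open>k\<close> can be read there.\<close>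
  define r where "r k = nf (s (N (Suc k))) ! k" for k
  have r: "nf (s i) ! k = r k" if "i \<ge> N (Suc k)" for i k
    using N[of "Suc k" i "N (Suc k)"] that unfolding r_def by (metis lessI nth_take order_refl)
  \<comment> \<open>\<open>N\<close> need not be monotone, hence the maximum over all lengths up to
    \<open>n\<close>.\<close>
  have "take n (nf (s i)) = map r [0..<n]" if "i \<ge> Max ((\<lambda>k. N k) ` {..n})" for i n
  proof -
    have *: "i \<ge> N k" if "k \<le> n" for k
      using \<open>i \<ge> _\<close> that by (meson Max_ge atMost_iff finite_atMost finite_imageI image_eqI le_trans)
    show ?thesis
    proof (rule nth_equalityI)
      show "length (take n (nf (s i))) = length (map r [0..<n])"
        using N[of n i i] * by simp
    next
      fix k assume "k < length (take n (nf (s i)))"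
      then show "take n (nf (s i)) ! k = map r [0..<n] ! k"
        using r[of k i] *[of "Suc k"] by simp
    qed
  qed
  then have "tends s r" using s unfolding tends_def eventually_sequentially by blast
  then show ?thesis by blast
qed

lemma tends_converges:
  assumes "tends s r"
  shows "converges_to_infinity G A s"
  using tends_close[OF assms assms] tends_carrier[OF assms]
  by (simp add: converges_to_infinity_def)

lemma tends_prefix_redw: "tends s r \<Longrightarrow> map r [0..<n] \<in> redw"
proof -
  assume s: "tends s r"
  obtain N where N: "\<And>i. i \<ge> N \<Longrightarrow> take n (nf (s i)) = map r [0..<n]" using tendsD[OF s, of n] by blast
  have "nf (s N) \<in> redw" using tends_carrier[OF s] nf_reduced by blast
  then have "take n (nf (s N)) \<in> redw" by (metis append_take_drop_id redw_appendD)
  then show ?thesis using N[of N] by simp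
qed

lemma ray_iff: "ray r \<longleftrightarrow> (\<forall>n. map r [0..<n] \<in> redw)"
proof
  assume r: "ray r"
  have "successively (\<lambda>a b. b \<noteq> inv a) (map r [0..<n])" for n
  proof (induction n)
    case (Suc n)
    then show ?case
      using r by (cases n) (auto simp: successively_append_iff ray_def)
  qed simp
  then show "\<forall>n. map r [0..<n] \<in> redw"
    using r by (auto simp: reduced_words_def ray_def)
next
  assume *: "\<forall>n. map r [0..<n] \<in> redw"
  have "r i \<in> alph \<and> r (Suc i) \<noteq> inv (r i)" for i
    using *[rule_format, of "Suc (Suc i)"]
    by (auto simp: reduced_words_def successively_append_iff)
  then show "ray r" by (auto simp: ray_def)
qed

lemma tends_ray: "tends s r \<Longrightarrow> ray r"
  using tends_prefix_redw ray_iff by blast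

lemma ray_prefix_carrier: "ray r \<Longrightarrow> ray_prefix r n \<in> carrier G"
  using redw_carrier ray_iff by blast

lemma nf_ray_prefix: "ray r \<Longrightarrow> nf (ray_prefix r n) = map r [0..<n]"
  using nf_word_prod ray_iff by blast

lemma ray_tends:
  assumes "ray r"
  shows "tends (ray_prefix r) r"
  unfolding tends_def eventually_sequentially
proof (intro conjI allI)
  show "range (ray_prefix r) \<subseteq> carrier G" using ray_prefix_carrier[OF assms] by auto
  fix n
  have "take n (nf (ray_prefix r i)) = map r [0..<n]" if "i \<ge> n" for i
    using that by (simp add: nf_ray_prefix[OF assms] take_map)
  then show "\<exists>N. \<forall>i\<ge>N. take n (nf (ray_prefix r i)) = map r [0..<n]" by blast
qed

lemma ray_prefix_in_end: "ray r \<Longrightarrow> ray_prefix r \<in> ray_end r"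
  by (simp add: ray_end_def ray_tends)

lemma ray_end_inj:
  assumes "ray r" "ray_end r = ray_end r'"
  shows "r = r'"
proof -
  have "tends (ray_prefix r) r" "tends (ray_prefix r) r'"
    using ray_prefix_in_end[OF assms(1)] assms(2) by (auto simp: ray_end_def)
  then show ?thesis using tends_unique tends_close by blast
qed

section \<open>Boundary points and open sets for an arbitrary finite generating set\<close>

context
  fixes S
  assumes S: "generated_group G S"
begin

lemma converges_to_infinity_iff: "converges_to_infinity G S s \<longleftrightarrow> (\<exists>r. tends s r)"
  using gromov_close_iff[OF S, of s s] converges_tends tends_converges
  unfolding converges_to_infinity_def by blast

lemma boundary_point_eq:
  assumes "tends s r"
  shows "boundary_point G S s = ray_end r"
  unfolding boundary_point_def ray_end_def
proof (intro Collect_cong iffI conjI)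
  fix t
  assume *: "converges_to_infinity G S t \<and> gromov_close G S s t"
  then have t: "range t \<subseteq> carrier G" by (simp add: converges_to_infinity_def)
  then show "tends t r"
    using * gromov_close_iff[OF S tends_carrier[OF assms] t] tends_if_close[OF assms t] by simp
next
  fix t assume t: "tends t r"
  then show "converges_to_infinity G S t" using converges_to_infinity_iff by blast
  show "gromov_close G S s t"
    using gromov_close_iff[OF S tends_carrier[OF assms] tends_carrier[OF t]] tends_close[OF assms t]
    by simp
qed

lemma gromov_boundary_eq: "gromov_boundary G S = ray_end ` {r. ray r}"
  unfolding gromov_boundary_def
proof safe
  fix s assume "converges_to_infinity G S s"
  then obtain r where "tends s r" using converges_to_infinity_iff by blast
  then show "boundary_point G S s \<in> ray_end ` {r. ray r}"
    using boundary_point_eq tends_ray by blast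
next
  fix r assume "ray r"
  then show "ray_end r \<in> boundary_point G S ` {s. converges_to_infinity G S s}"
    using boundary_point_eq[OF ray_tends] converges_to_infinity_iff ray_tends by blast
qed

lemma word_endpoint_ray: "ray r \<Longrightarrow> word_endpoint G S r = ray_end r"
  unfolding word_endpoint_def by (intro boundary_point_eq ray_tends)

text \<open>These open sets will show that the complement of the lamination in the example is
  open.\<close>

lemma boundary_open_cylinder:
  "boundary_open G S {ray_end r' | r'. ray r' \<and> (\<forall>i<n. r' i = r i)}" (is "boundary_open G S ?U")
  unfolding boundary_open_def
proof (intro conjI ballI)
  show "?U \<subseteq> gromov_boundary G S" by (auto simp: gromov_boundary_eq)
  fix \<xi> assume "\<xi> \<in> ?U"
  then obtain r1 where r1: "ray r1" "\<And>i. i < n \<Longrightarrow> r1 i = r i" "\<xi> = ray_end r1" by auto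
  obtain M :: nat where M: "M \<ge> 1"
    "\<And>g h. g \<in> carrier G \<Longrightarrow> h \<in> carrier G \<Longrightarrow>
      gromov_product G A g h \<le> M * gromov_product G S g h + M"
    "\<And>g h. g \<in> carrier G \<Longrightarrow> h \<in> carrier G \<Longrightarrow>
      gromov_product G S g h \<le> M * gromov_product G A g h + M"
    using gromov_product_comparison[OF S] by blast
  \<comment> \<open>By the comparison, a product of at least \<open>M * n + M\<close> over
    \<open>S\<close> forces one of at least \<open>n\<close> over \<open>A\<close>, that is,
    \<open>n\<close> common letters.\<close>
  have "boundary_nbhd G S \<xi> (M * n + M) \<subseteq> ?U"
  proof
    fix \<eta> assume "\<eta> \<in> boundary_nbhd G S \<xi> (M * n + M)"
    then obtain r2 s t where r2: "ray r2" "\<eta> = ray_end r2" and st: "tends s r1" "tends t r2"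
      and ev: "\<forall>\<^sub>F (i, j) in sequentially \<times>\<^sub>F sequentially. gromov_product G S (s i) (t j) \<ge> M * n + M"
      unfolding boundary_nbhd_def gromov_boundary_eq r1(3) by (auto simp: ray_end_def)
    obtain N where N: "\<And>i j. i \<ge> N \<Longrightarrow> j \<ge> N \<Longrightarrow> gromov_product G S (s i) (t j) \<ge> M * n + M"
      using ev unfolding eventually_prod_sequentially by auto
    obtain N1 where N1: "\<And>i. i \<ge> N1 \<Longrightarrow> take n (nf (s i)) = map r1 [0..<n]"
      using tendsD[OF st(1), of n] by blast
    obtain N2 where N2: "\<And>i. i \<ge> N2 \<Longrightarrow> take n (nf (t i)) = map r2 [0..<n]"
      using tendsD[OF st(2), of n] by blast
    define k where "k = max N (max N1 N2)"
    have k: "k \<ge> N" "k \<ge> N1" "k \<ge> N2" by (auto simp: k_def)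
    have c: "s k \<in> carrier G" "t k \<in> carrier G"
      using tends_carrier[OF st(1)] tends_carrier[OF st(2)] by auto
    have "real M * real n \<le> real M * gromov_product G A (s k) (t k)"
      using N[OF k(1) k(1)] M(3)[OF c] by simp
    then have "real n \<le> gromov_product G A (s k) (t k)" using M(1) by simp
    then have "map r1 [0..<n] = map r2 [0..<n]"
      using N1[OF k(2)] N2[OF k(3)] c by (simp add: le_gromov_product_iff)
    then have "\<forall>i<n. r2 i = r i" using r1(2) by simp
    then show "\<eta> \<in> ?U" using r2 by blast
  qed
  then show "\<exists>\<rho>. boundary_nbhd G S \<xi> \<rho> \<subseteq> ?U" by blast
qed

end

end

section \<open>Lines and shift invariance\<close>

lemma map_upt_append: "map f [0..<m + n] = map f [0..<m] @ map (\<lambda>i. f (m + i)) [0..<n]"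
  by (rule nth_equalityI) (auto simp: nth_append)

lemma algebraic_lamination_subset:
  assumes "algebraic_lamination G S L"
  shows "L \<subseteq> double_boundary G S"
proof -
  have "closedin (subtopology (prod_topology (boundary_topology G S) (boundary_topology G S))
      (double_boundary G S)) L"
    using assms unfolding algebraic_lamination_def by (elim conjE)
  then show ?thesis by (rule closedin_imp_subset)
qed

context based_group
begin

text \<open>Left multiplication by a letter, extended to infinite reduced words: the counterpart of
  \<open>nf_mult_letter\<close>.\<close>

definition act :: "'a \<Rightarrow> (nat \<Rightarrow> 'a) \<Rightarrow> nat \<Rightarrow> 'a"
  where "act a r = (if r 0 = inv a then (\<lambda>i. r (Suc i)) else case_nat a r)"

lemma tends_act:
  assumes a: "a \<in> alph" and s: "tends s r"
  shows "tends (\<lambda>i. a \<otimes> s i) (act a r)"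
  unfolding tends_def eventually_sequentially
proof (intro conjI allI)
  have c: "s i \<in> carrier G" for i using tends_carrier[OF s] by auto
  then show "range (\<lambda>i. a \<otimes> s i) \<subseteq> carrier G" using a by auto
  fix n
  \<comment> \<open>One letter more than \<open>n\<close>, because a cancellation uses up the first
    one.\<close>
  obtain N where N: "\<And>i. i \<ge> N \<Longrightarrow> take (Suc n) (nf (s i)) = map r [0..<Suc n]"
    using tendsD[OF s, of "Suc n"] by blast
  have "take n (nf (a \<otimes> s i)) = map (act a r) [0..<n]" if "i \<ge> N" for i
  proof -
    have *: "take (Suc n) (nf (s i)) = r 0 # map (\<lambda>i. r (Suc i)) [0..<n]"
      using N[OF that] by (simp add: map_upt_Suc del: upt_Suc)
    then obtain w where w: "nf (s i) = r 0 # w" by (cases "nf (s i)") auto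
    show ?thesis
    proof (cases "r 0 = inv a")
      case True
      then show ?thesis using * w nf_mult_letter[OF a c[of i]] by (simp add: act_def)
    next
      case False
      then have "nf (a \<otimes> s i) = a # nf (s i)" using w nf_mult_letter[OF a c[of i]] by simp
      moreover have "take m (nf (s i)) = map r [0..<m]" if "m \<le> n" for m
      proof -
        have "take m (take (Suc n) (nf (s i))) = take m (map r [0..<Suc n])"
          using N[OF \<open>i \<ge> N\<close>] by simp
        then show ?thesis using that by (simp add: take_map min_def del: upt_Suc)
      qed
      ultimately show ?thesis
        using False by (cases n) (simp_all add: act_def map_upt_Suc del: upt_Suc)
    qed
  qed
  then show "\<exists>N. \<forall>i\<ge>N. take n (nf (a \<otimes> s i)) = map (act a r) [0..<n]" by blast
qed

lemma act_inv:
  assumes "a \<in> alph" "ray r"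
  shows "act (inv a) (act a r) = r"
proof (cases "r 0 = inv a")
  case True
  \<comment> \<open>After \<open>inv a\<close> a reduced ray does not continue with
    \<open>a\<close>, so the second action prepends instead of cancelling.\<close>
  then have "r (Suc 0) \<noteq> inv (inv a)" using assms(2) unfolding ray_def by metis
  then show ?thesis using True by (auto simp: act_def fun_eq_iff split: nat.split)
next
  case False
  then show ?thesis using assms(1) by (auto simp: act_def)
qed

lemma ray_act: "a \<in> alph \<Longrightarrow> ray r \<Longrightarrow> ray (act a r)"
  using tends_act ray_tends tends_ray by blast

lemma boundary_action_letter:
  assumes a: "a \<in> alph" and r: "ray r"
  shows "boundary_action G a (ray_end r) = ray_end (act a r)"
  unfolding boundary_action_def ray_end_def
proof safe
  fix s assume "tends s r"
  then show "tends (\<lambda>i. a \<otimes> s i) (act a r)" by (rule tends_act[OF a])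
next
  fix t assume t: "tends t (act a r)"
  then have "tends (\<lambda>i. inv a \<otimes> t i) r"
    using tends_act[of "inv a" t "act a r"] a act_inv[OF a r] by simp
  moreover have "t i \<in> carrier G" for i using tends_carrier[OF t] by auto
  then have "t = (\<lambda>i. a \<otimes> (inv a \<otimes> t i))" using a by (simp add: mult_inv_cancel_left)
  ultimately show "t \<in> (\<lambda>s i. a \<otimes> s i) ` {s. tends s r}"
    by (intro image_eqI[where x = "\<lambda>i. inv a \<otimes> t i"]) auto
qed

lemma ray_shift: "ray r \<Longrightarrow> ray (\<lambda>i. r (k + i))"
  by (auto simp: ray_def)

text \<open>For rays, \<open>k\<close> is the Gromov product of the two ends: the distance in the
  tree from the base point to the line joining them.\<close>

definition fork :: "(nat \<Rightarrow> 'a) \<Rightarrow> (nat \<Rightarrow> 'a) \<Rightarrow> nat \<Rightarrow> bool"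
  where "fork l r k \<longleftrightarrow> (\<forall>i<k. l i = r i) \<and> l k \<noteq> r k"

lemma fork_exists: "l \<noteq> r \<Longrightarrow> \<exists>k. fork l r k"
  unfolding fork_def fun_eq_iff using exists_least_iff[of "\<lambda>k. l k \<noteq> r k"] by blast

text \<open>The label of the geodesic joining the two ends, with the branch vertex between positions
  0 and 1. The left half is \<open>l\<close> read backwards and inverted, matching
  \<open>endpoint_pair\<close>.\<close>

definition line :: "(nat \<Rightarrow> 'a) \<Rightarrow> (nat \<Rightarrow> 'a) \<Rightarrow> nat \<Rightarrow> int \<Rightarrow> 'a"
  where "line l r k j = (if 1 \<le> j then r (k + nat (j - 1)) else inv (l (k + nat (- j))))"

abbreviation left_ray :: "(int \<Rightarrow> 'a) \<Rightarrow> nat \<Rightarrow> 'a"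
  where "left_ray x \<equiv> \<lambda>i. inv (x (- int i))"

abbreviation right_ray :: "(int \<Rightarrow> 'a) \<Rightarrow> nat \<Rightarrow> 'a"
  where "right_ray x \<equiv> \<lambda>i. x (int i + 1)"

lemma right_ray_line: "right_ray (line l r k) = (\<lambda>i. r (k + i))"
  by (simp add: line_def)

lemma left_ray_line: "ray l \<Longrightarrow> left_ray (line l r k) = (\<lambda>i. l (k + i))"
  by (auto simp: line_def ray_def image_subset_iff)

lemma line_reduced:
  assumes "ray l" "ray r" "fork l r k"
  shows "line l r k \<in> reduced_biinfinite G A"
proof -
  have "line l r k (j + 1) \<noteq> inv (line l r k j)" for j
  proof -
    consider "j \<ge> 1" | "j = 0" | "j < 0" by linarith
    then show ?thesis
    proof cases
      case 1
      then have "line l r k (j + 1) = r (Suc (k + nat (j - 1)))" "line l r k j = r (k + nat (j - 1))"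
        by (auto simp: line_def nat_diff_distrib' intro!: arg_cong[of _ _ r])
      then show ?thesis using assms(2) by (auto simp: ray_def)
    next
      case 2
      \<comment> \<open>The junction of the two halves: a cancellation here would mean
        \<open>l k = r k\<close>, against the fork.\<close>
      then show ?thesis using assms by (auto simp: line_def fork_def ray_def image_subset_iff)
    next
      case 3
      then have "k + nat (- j) = Suc (k + nat (- j - 1))" "nat (- (j + 1)) = nat (- j - 1)" by auto
      then have *: "line l r k (j + 1) = inv (l (k + nat (- j - 1)))"
        "line l r k j = inv (l (Suc (k + nat (- j - 1))))"
        using 3 by (auto simp: line_def)
      have "l (k + nat (- j - 1)) \<in> alph" "l (Suc (k + nat (- j - 1))) \<in> alph"
        "l (Suc (k + nat (- j - 1))) \<noteq> inv (l (k + nat (- j - 1)))"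
        using assms(1) by (auto simp: ray_def)
      then show ?thesis unfolding * by (metis alph_carrier inv_inv)
    qed
  qed
  moreover have "range (line l r k) \<subseteq> alph"
    using assms(1,2) by (auto simp: line_def ray_def image_subset_iff)
  ultimately show ?thesis by (simp add: reduced_biinfinite_def)
qed

lemma rays_of_biinfinite:
  assumes x: "x \<in> reduced_biinfinite G A"
  shows "ray (left_ray x)" "ray (right_ray x)" "inv (x 0) \<noteq> x 1"
proof -
  have a: "x i \<in> alph" and r: "x (i + 1) \<noteq> inv (x i)" for i
    using x by (auto simp: reduced_biinfinite_def)
  show "inv (x 0) \<noteq> x 1" using r[of 0] by simp
  have "inv (x (- int (Suc i))) \<noteq> inv (inv (x (- int i)))" for i
  proof -
    have "x (- int i) \<noteq> inv (x (- int (Suc i)))" using r[of "- int (Suc i)"] by simp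
    then show ?thesis using a by (metis alph_carrier inv_inv)
  qed
  then show "ray (left_ray x)" using a by (auto simp: ray_def)
  have "x (int (Suc i) + 1) \<noteq> inv (x (int i + 1))" for i
    using r[of "int i + 1"] by (simp add: algebra_simps)
  then show "ray (right_ray x)" using a by (auto simp: ray_def)
qed

section \<open>Translating the lines of a lamination and shifting its biinfinite words\<close>

context
  fixes S
  assumes S: "generated_group G S"
begin

lemma endpoint_pair_rays:
  "x \<in> reduced_biinfinite G A \<Longrightarrow> endpoint_pair G S x = (ray_end (left_ray x), ray_end (right_ray x))"
  unfolding endpoint_pair_def by (simp add: word_endpoint_ray[OF S] rays_of_biinfinite)

lemma in_lamination_subshift_iff:
  "x \<in> lamination_subshift G S A L \<longleftrightarrow>
    x \<in> reduced_biinfinite G A \<and> (ray_end (left_ray x), ray_end (right_ray x)) \<in> L"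
  unfolding lamination_subshift_def using endpoint_pair_rays by auto

context
  fixes L
  assumes L: "algebraic_lamination G S L"
begin

lemma lamination_act:
  assumes "a \<in> alph" "ray l" "ray r" "(ray_end l, ray_end r) \<in> L"
  shows "(ray_end (act a l), ray_end (act a r)) \<in> L"
proof -
  have "(boundary_action G a (ray_end l), boundary_action G a (ray_end r)) \<in> L"
    using L assms unfolding algebraic_lamination_def by auto
  then show ?thesis using assms by (simp add: boundary_action_letter)
qed

text \<open>Removing a common first letter from both rays is translation by its inverse. Repeating
  this moves the line until it passes through the base point.\<close>

lemma lamination_drop:
  assumes "ray l" "ray r" "(ray_end l, ray_end r) \<in> L" "\<forall>i<k. l i = r i"
  shows "(ray_end (\<lambda>i. l (k + i)), ray_end (\<lambda>i. r (k + i))) \<in> L"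
  using assms(4)
proof (induction k)
  case 0
  then show ?case using assms by simp
next
  case (Suc k)
  have a: "r k \<in> alph" using assms(2) by (auto simp: ray_def)
  have "(ray_end (act (inv (r k)) (\<lambda>i. l (k + i))), ray_end (act (inv (r k)) (\<lambda>i. r (k + i)))) \<in> L"
    using Suc assms a by (intro lamination_act ray_shift) auto
  then show ?case using a Suc.prems by (simp add: act_def)
qed

lemma line_in_subshift:
  assumes "ray l" "ray r" "(ray_end l, ray_end r) \<in> L" "fork l r k"
  shows "line l r k \<in> lamination_subshift G S A L"
  unfolding in_lamination_subshift_iff right_ray_line left_ray_line[OF assms(1)]
  using line_reduced lamination_drop assms by (simp add: fork_def)

lemma lamination_rays:
  assumes "(\<xi>, \<eta>) \<in> L"
  obtains l r k where "ray l" "ray r" "\<xi> = ray_end l" "\<eta> = ray_end r" "fork l r k"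
proof -
  have "(\<xi>, \<eta>) \<in> double_boundary G S" using algebraic_lamination_subset[OF L] assms by blast
  then obtain l r where lr: "ray l" "ray r" "\<xi> = ray_end l" "\<eta> = ray_end r" "l \<noteq> r"
    unfolding double_boundary_def gromov_boundary_eq[OF S] by auto
  obtain k where k: "fork l r k" using fork_exists[OF lr(5)] ..
  show ?thesis by (rule that[OF lr(1-4) k])
qed

lemma subshift_nonempty: "lamination_subshift G S A L \<noteq> {}"
proof -
  have "L \<noteq> {}" using L unfolding algebraic_lamination_def by (rule conjunct1)
  then obtain \<xi> \<eta> where "(\<xi>, \<eta>) \<in> L" by auto
  then obtain l r k where "ray l" "ray r" "\<xi> = ray_end l" "\<eta> = ray_end r" "fork l r k"
    by (rule lamination_rays)
  then have "line l r k \<in> lamination_subshift G S A L"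
    using \<open>(\<xi>, \<eta>) \<in> L\<close> by (intro line_in_subshift) simp_all
  then show ?thesis by auto
qed

text \<open>A shift is a translation along the line. Acting by \<open>inv (x 1)\<close> removes the
  first letter of the right ray and is prepended to the left one, where nothing cancels because
  \<open>x\<close> is reduced; acting by \<open>x 0\<close> does the opposite.\<close>

lemma subshift_shift:
  assumes x: "x \<in> lamination_subshift G S A L"
  shows "(\<lambda>j. x (j + 1)) \<in> lamination_subshift G S A L"
    and "(\<lambda>j. x (j - 1)) \<in> lamination_subshift G S A L"
proof -
  let ?y = "\<lambda>j. x (j + 1)" and ?z = "\<lambda>j. x (j - 1)"
  have xr: "x \<in> reduced_biinfinite G A" and xL: "(ray_end (left_ray x), ray_end (right_ray x)) \<in> L"
    using x unfolding in_lamination_subshift_iff by blast+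
  have a: "x i \<in> alph" and r: "x (i + 1) \<noteq> inv (x i)" for i
    using xr unfolding reduced_biinfinite_def by blast+
  note rays = rays_of_biinfinite[OF xr]
  have "?y \<in> reduced_biinfinite G A"
    unfolding reduced_biinfinite_def using a r by blast
  moreover have "act (inv (x 1)) (right_ray x) = right_ray ?y"
    using a[of 1] by (simp add: act_def algebra_simps)
  moreover have "act (inv (x 1)) (left_ray x) = left_ray ?y"
  proof
    fix i
    show "act (inv (x 1)) (left_ray x) i = left_ray ?y i"
      using a[of 1] rays(3) by (cases i) (simp_all add: act_def)
  qed
  ultimately show "?y \<in> lamination_subshift G S A L"
    using lamination_act[of "inv (x 1)", OF _ rays(1,2) xL] a[of 1]
    unfolding in_lamination_subshift_iff by simp
  have "x (j - 1 + 1) \<noteq> inv (x (j - 1))" for j by (rule r)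
  then have "?z \<in> reduced_biinfinite G A"
    unfolding reduced_biinfinite_def using a by auto
  moreover have "act (x 0) (right_ray x) = right_ray ?z"
  proof
    fix i
    show "act (x 0) (right_ray x) i = right_ray ?z i"
      using rays(3) by (cases i) (auto simp add: act_def algebra_simps)
  qed
  moreover have "act (x 0) (left_ray x) = left_ray ?z"
  proof
    fix i
    have "x (- 1 - int i) = x (- int i - 1)" by (rule arg_cong[of _ _ x]) simp
    then show "act (x 0) (left_ray x) i = left_ray ?z i" by (simp add: act_def)
  qed
  ultimately show "?z \<in> lamination_subshift G S A L"
    using lamination_act[of "x 0", OF _ rays(1,2) xL] a[of 0]
    unfolding in_lamination_subshift_iff by simp
qed

lemma subshift_shift_any:
  assumes x: "x \<in> lamination_subshift G S A L"
  shows "(\<lambda>j. x (j + k)) \<in> lamination_subshift G S A L"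
proof (induction k rule: int_induct[where k = 0])
  case base
  then show ?case using x by simp
next
  case (step1 i)
  then show ?case using subshift_shift(1)[OF step1(2)] by (simp add: algebra_simps)
next
  case (step2 i)
  then show ?case using subshift_shift(2)[OF step2(2)] by (simp add: algebra_simps)
qed

end

end

end

section \<open>Complexity under a change of basis\<close>

definition words :: "(int \<Rightarrow> 'c) set \<Rightarrow> nat \<Rightarrow> 'c list set"
  where "words X n = {w \<in> language X. length w = n}"

lemma complexity_words: "complexity X n = card (words X n)"
  by (simp add: complexity_def words_def)

lemma words_eq: "words X n = {map (\<lambda>i. x (k + int i)) [0..<n] | x k. x \<in> X}"
  unfolding words_def language_def by force

lemma words_append_subset:
  "words X (m + n) \<subseteq> (\<lambda>(v, w). v @ w) ` (words X m \<times> words X n)"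
proof
  fix u assume "u \<in> words X (m + n)"
  then obtain x k where x: "x \<in> X" "u = map (\<lambda>i. x (k + int i)) [0..<m + n]"
    unfolding words_eq by blast
  then have "u = map (\<lambda>i. x (k + int i)) [0..<m] @ map (\<lambda>i. x ((k + int m) + int i)) [0..<n]"
    by (simp add: map_upt_append add.assoc)
  moreover have "map (\<lambda>i. x (k + int i)) [0..<m] \<in> words X m"
    "map (\<lambda>i. x ((k + int m) + int i)) [0..<n] \<in> words X n"
    unfolding words_eq using x(1) by blast+
  ultimately show "u \<in> (\<lambda>(v, w). v @ w) ` (words X m \<times> words X n)" by force
qed

lemma words_take: "words X n \<subseteq> take n ` words X (n + k)"
proof
  fix u assume "u \<in> words X n"
  then obtain x j where x: "x \<in> X" "u = map (\<lambda>i. x (j + int i)) [0..<n]"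
    unfolding words_eq by blast
  then have "u = take n (map (\<lambda>i. x (j + int i)) [0..<n + k])" by (simp add: take_map)
  moreover have "map (\<lambda>i. x (j + int i)) [0..<n + k] \<in> words X (n + k)"
    unfolding words_eq using x(1) by blast
  ultimately show "u \<in> take n ` words X (n + k)" by blast
qed

locale finite_alphabet_shift =
  fixes X :: "(int \<Rightarrow> 'c) set" and F :: "'c set"
  assumes nonempty: "X \<noteq> {}" and finite_alphabet: "finite F"
    and range_subset: "\<And>x. x \<in> X \<Longrightarrow> range x \<subseteq> F"
begin

lemma finite_words: "finite (words X n)"
proof (rule finite_subset)
  show "words X n \<subseteq> {w. set w \<subseteq> F \<and> length w = n}"
    unfolding words_eq using range_subset by (auto simp: image_subset_iff)
  show "finite {w. set w \<subseteq> F \<and> length w = n}" using finite_alphabet by (rule finite_lists_length_eq)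
qed

lemma complexity_pos: "complexity X n \<ge> 1"
proof -
  have "words X n \<noteq> {}" unfolding words_eq using nonempty by blast
  then show ?thesis
    unfolding complexity_words using finite_words by (simp add: Suc_le_eq card_gt_0_iff)
qed

lemma complexity_mono: "m \<le> n \<Longrightarrow> complexity X m \<le> complexity X n"
  unfolding complexity_words using words_take[of X m "n - m"] finite_words
  by (metis surj_card_le le_add_diff_inverse)

lemma complexity_submult: "complexity X (m + n) \<le> complexity X m * complexity X n"
  unfolding complexity_words card_cartesian_product[symmetric]
  by (rule surj_card_le[OF _ words_append_subset]) (simp add: finite_words)

end

lemma finite_alphabet_lamination_subshift:
  assumes A: "based_group G A" and S: "generated_group G S" and L: "algebraic_lamination G S L"
  shows "finite_alphabet_shift (lamination_subshift G S A L) (letters G A)"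
proof -
  interpret A: based_group G A by fact
  show ?thesis
  proof
    show "lamination_subshift G S A L \<noteq> {}" by (rule A.subshift_nonempty[OF S L])
    show "finite (letters G A)" by (rule A.finite_letters[OF A.finite_basis[OF S]])
    show "range x \<subseteq> letters G A" if "x \<in> lamination_subshift G S A L" for x
      using that unfolding lamination_subshift_def reduced_biinfinite_def by blast
  qed
qed

text \<open>
  Let \<open>v\<close> and \<open>r\<close> be the rays of \<open>\<eta>\<close> over \<open>B\<close> and over \<open>A\<close>. By the comparison of Gromov
  products the first \<open>n\<close> letters of \<open>v\<close> can be read off from the first \<open>M + M n\<close> letters of \<open>r\<close>,
  and the two lines from \<open>\<xi>\<close> to \<open>\<eta>\<close> pass at bounded distance, so that all but the first \<open>M\<close>
  of these letters lie on the line over \<open>A\<close>.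
\<close>
lemma complexity_transfer:
  assumes A: "based_group G A" and B: "based_group G B"
    and S: "generated_group G S" and L: "algebraic_lamination G S L"
  obtains C M :: nat where "C \<ge> 1" "M \<ge> 1"
    "\<And>n. complexity (lamination_subshift G S B L) n
      \<le> C * complexity (lamination_subshift G S A L) (M * n)"
proof -
  interpret A: based_group G A by fact
  interpret B: based_group G B by fact
  interpret X: finite_alphabet_shift "lamination_subshift G S A L" "letters G A"
    by (rule finite_alphabet_lamination_subshift[OF A S L])
  let ?X = "lamination_subshift G S A L" and ?Y = "lamination_subshift G S B L"
  have genB: "generated_group G B" by (rule B.generated_group_basis[OF B.finite_basis[OF S]])
  obtain M :: nat where M: "M \<ge> 1"
    "\<And>g h. g \<in> carrier G \<Longrightarrow> h \<in> carrier G \<Longrightarrow>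
      gromov_product G A g h \<le> M * gromov_product G B g h + M"
    "\<And>g h. g \<in> carrier G \<Longrightarrow> h \<in> carrier G \<Longrightarrow>
      gromov_product G B g h \<le> M * gromov_product G A g h + M"
    using A.gromov_product_comparison[OF genB] by blast
  \<comment> \<open>The possible first \<open>M\<close> letters of \<open>r\<close>, part of which
    may lie off the line; their number gives the constant \<open>C\<close>.\<close>
  define P where "P = {a. set a \<subseteq> letters G A \<and> length a = M}"
  have "finite P" unfolding P_def by (rule finite_lists_length_eq[OF X.finite_alphabet])
  have "words ?Y n \<subseteq> (\<lambda>(a, t). take n (B.nf (word_prod G (a @ t)))) ` (P \<times> words ?X (M * n))" for n
  proof
    fix w assume "w \<in> words ?Y n"
    then obtain y0 j where y0: "y0 \<in> ?Y" "w = map (\<lambda>i. y0 (j + int i)) [0..<n]"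
      unfolding words_eq by blast
    \<comment> \<open>Moves the occurrence of \<open>w\<close> to position 1, where the right ray
      starts.\<close>
    define y where "y i = y0 (i + (j - 1))" for i
    have "y \<in> ?Y" unfolding y_def by (rule B.subshift_shift_any[OF S L y0(1)])
    define q m where "q = B.right_ray y" and "m = B.left_ray y"
    have w: "w = map q [0..<n]" unfolding y0(2) q_def y_def by (simp add: algebra_simps)
    have yr: "y \<in> reduced_biinfinite G B" and "(B.ray_end m, B.ray_end q) \<in> L"
      using \<open>y \<in> ?Y\<close> B.in_lamination_subshift_iff[OF S] unfolding q_def m_def by auto
    then obtain l r k where lr: "A.ray l" "A.ray r"
      "B.ray_end m = A.ray_end l" "B.ray_end q = A.ray_end r" "A.fork l r k"
      using A.lamination_rays[OF S L] by blast
    have rays: "B.ray m" "B.ray q" "m 0 \<noteq> q 0"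
      using B.rays_of_biinfinite[OF yr] by (simp_all add: m_def q_def)
    \<comment> \<open>\<open>m\<close> and \<open>q\<close> part at once, so their prefixes have
      Gromov product 0 over \<open>B\<close> and hence at most \<open>M\<close> over
      \<open>A\<close>; the latter bounds the common prefix of \<open>l\<close> and
      \<open>r\<close>.\<close>
    have "k \<le> M"
    proof -
      have t: "A.tends (B.ray_prefix m) l" "A.tends (B.ray_prefix q) r"
        using B.ray_prefix_in_end rays lr unfolding A.ray_end_def by blast+
      obtain N1 where N1: "\<And>i. i \<ge> N1 \<Longrightarrow> take k (A.nf (B.ray_prefix m i)) = map l [0..<k]"
        using A.tendsD[OF t(1), of k] by blast
      obtain N2 where N2: "\<And>i. i \<ge> N2 \<Longrightarrow> take k (A.nf (B.ray_prefix q i)) = map r [0..<k]"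
        using A.tendsD[OF t(2), of k] by blast
      define i where "i = max N1 N2"
      let ?g = "B.ray_prefix m i" and ?h = "B.ray_prefix q i"
      have c: "?g \<in> carrier G" "?h \<in> carrier G" using rays B.ray_prefix_carrier by auto
      have tk: "take k (A.nf ?g) = map l [0..<k]" "take k (A.nf ?h) = map r [0..<k]"
        using N1[of i] N2[of i] by (simp_all add: i_def)
      moreover have "map l [0..<k] = map r [0..<k]" using lr(5) by (simp add: A.fork_def)
      ultimately have "real k \<le> gromov_product G A ?g ?h"
        using c A.take_eq_map_length[OF tk(1)] A.take_eq_map_length[OF tk(2)]
        by (simp add: A.le_gromov_product_iff)
      also have "\<dots> \<le> M * gromov_product G B ?g ?h + M" by (rule M(2)[OF c])
      also have "gromov_product G B ?g ?h = real (length ([] :: 'a list))"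
      proof (rule B.gromov_product_common_prefix[OF c])
        show "map m [0..<i] = [] \<or> map q [0..<i] = [] \<or> hd (map m [0..<i]) \<noteq> hd (map q [0..<i])"
          using rays(3) by (cases i) (simp_all add: map_upt_Suc del: upt_Suc)
      qed (use rays in \<open>simp_all add: B.nf_ray_prefix\<close>)
      finally show ?thesis by simp
    qed
    define x where "x = A.line l r k"
    have "x \<in> ?X" unfolding x_def
      using \<open>(B.ray_end m, B.ray_end q) \<in> L\<close> lr by (intro A.line_in_subshift[OF S L]) auto
    define a t where "a = map r [0..<M]" and "t = map (\<lambda>i. r (M + i)) [0..<M * n]"
    have "a \<in> P" using lr(2) by (auto simp: a_def P_def A.ray_def)
    \<comment> \<open>The line has \<open>r k\<close> at position 1, so \<open>r M\<close>, the
      first letter after \<open>a\<close>, stands at position \<open>1 + (M - k)\<close>.\<close>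
    have "t = map (\<lambda>i. x ((1 + int (M - k)) + int i)) [0..<M * n]"
    proof -
      have "x ((1 + int (M - k)) + int i) = r (M + i)" for i
      proof -
        have "nat (int M + (int i - int k)) = M - k + i" using \<open>k \<le> M\<close> by arith
        then show ?thesis using \<open>k \<le> M\<close> by (simp add: x_def A.line_def)
      qed
      then show ?thesis by (simp add: t_def)
    qed
    then have "t \<in> words ?X (M * n)" unfolding words_eq using \<open>x \<in> ?X\<close> by blast
    let ?h = "A.ray_prefix r"
    have "take n (B.nf (?h (M + M * n))) = map q [0..<n]"
    proof -
      \<comment> \<open>The prefixes of \<open>r\<close> over \<open>A\<close> represent the common
        boundary point, so as group elements they also converge to \<open>q\<close> over
        \<open>B\<close>.\<close>
      have "B.tends ?h q"
        using A.ray_prefix_in_end[OF lr(2)] lr(4) unfolding B.ray_end_def by blast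
      then obtain N where N: "\<And>i. i \<ge> N \<Longrightarrow> take n (B.nf (?h i)) = map q [0..<n]"
        using B.tendsD[of ?h q n] by blast
      let ?j = "M + M * n"
      define i where "i = max N ?j"
      have i: "i \<ge> N" "i \<ge> ?j" by (auto simp: i_def)
      have c: "?h i \<in> carrier G" "?h ?j \<in> carrier G" using lr(2) A.ray_prefix_carrier by auto
      have "real ?j \<le> gromov_product G A (?h i) (?h ?j)"
        using i(2) lr(2) by (subst A.le_gromov_product_iff[OF c]) (simp add: A.nf_ray_prefix take_map)
      also have "\<dots> \<le> M * gromov_product G B (?h i) (?h ?j) + M" by (rule M(2)[OF c])
      finally have "real M * real n \<le> real M * gromov_product G B (?h i) (?h ?j)" by simp
      then have "real n \<le> gromov_product G B (?h i) (?h ?j)" using M(1) by simp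
      then show ?thesis using N[OF i(1)] c by (simp add: B.le_gromov_product_iff)
    qed
    moreover have "map r [0..<M + M * n] = a @ t" by (simp add: a_def t_def map_upt_append)
    ultimately have "w = take n (B.nf (word_prod G (a @ t)))" using w by simp
    then show "w \<in> (\<lambda>(a, t). take n (B.nf (word_prod G (a @ t)))) ` (P \<times> words ?X (M * n))"
      using \<open>a \<in> P\<close> \<open>t \<in> words ?X (M * n)\<close> by force
  qed
  then have "card (words ?Y n) \<le> card (P \<times> words ?X (M * n))" for n
    by (rule surj_card_le[rotated]) (simp add: \<open>finite P\<close> X.finite_words)
  then have le: "complexity ?Y n \<le> card P * complexity ?X (M * n)" for n
    by (simp add: complexity_words card_cartesian_product)
  have "complexity ?Y n \<le> (card P + 1) * complexity ?X (M * n)" for n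
    using le[of n] by (simp add: algebra_simps)
  then show ?thesis using that[of "card P + 1" M] M(1) by simp
qed

section \<open>Entropy\<close>

text \<open>Fekete's lemma. The limit is the infimum of the quotients, so a count at a single length
  already bounds the entropy from above.\<close>

lemma subadditive_limit:
  fixes f :: "nat \<Rightarrow> real"
  assumes nonneg: "\<And>n. 0 \<le> f n" and sub: "\<And>m n. f (m + n) \<le> f m + f n"
  obtains h where "(\<lambda>n. f n / real n) \<longlonglongrightarrow> h" "\<And>k. k \<ge> 1 \<Longrightarrow> h \<le> f k / real k"
proof -
  define h where "h = (INF k\<in>{1..}. f k / real k)"
  have bdd: "bdd_below ((\<lambda>k. f k / real k) ` {1..})"
    using nonneg by (intro bdd_belowI2[of _ 0]) simp
  have h_le: "h \<le> f k / real k" if "k \<ge> 1" for k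
    unfolding h_def using bdd that by (intro cINF_lower) auto
  have mult: "f (q * k + r) \<le> real q * f k + f r" for q k r
  proof (induction q)
    case (Suc q)
    have "f (Suc q * k + r) \<le> f k + f (q * k + r)" using sub[of k "q * k + r"] by (simp add: add.assoc)
    then show ?case using Suc by (simp add: algebra_simps)
  qed simp
  have "(\<lambda>n. f n / real n) \<longlonglongrightarrow> h"
  proof (rule LIMSEQ_I)
    fix e :: real assume "e > 0"
    then have "\<exists>k\<in>{1..}. f k / real k < h + e / 2"
      using cINF_less_iff[OF _ bdd, of "h + e / 2"] unfolding h_def[symmetric] by auto
    then obtain k where k: "k \<ge> 1" "f k / real k < h + e / 2" by auto
    define B where "B = Max (f ` {..<k})"
    have B: "f r \<le> B" if "r < k" for r unfolding B_def using that by (intro Max_ge) auto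
    then have "B \<ge> 0" using nonneg[of 0] k by (meson less_le_trans zero_less_one order_trans)
    obtain N where N: "real N > 2 * B / e" using reals_Archimedean2 by blast
    have "norm (f n / real n - h) < e" if "n \<ge> max N 1" for n
    proof -
      have n: "n \<ge> 1" "n \<ge> N" using that by auto
      have "f n \<le> real (n div k) * f k + f (n mod k)" using mult[of "n div k" k "n mod k"] by simp
      also have "real (n div k) * f k = real (n div k) * real k * (f k / real k)"
        using k by simp
      also have "\<dots> \<le> real n * (f k / real k)"
        using nonneg[of k] by (intro mult_right_mono)
          (auto simp flip: of_nat_mult simp: div_times_less_eq_dividend)
      also have "f (n mod k) \<le> B" using B k by simp
      finally have "f n \<le> real n * (f k / real k) + B" by simp
      then have "f n / real n \<le> f k / real k + B / real n"
        using n by (simp add: field_simps)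
      moreover have "B / real n < e / 2"
      proof -
        have "2 * B / e < real n" using N n by linarith
        then show ?thesis using \<open>e > 0\<close> n by (simp add: field_simps)
      qed
      ultimately have "f n / real n < h + e" using k by linarith
      then show ?thesis using h_le[OF n(1)] by simp
    qed
    then show "\<exists>N. \<forall>n\<ge>N. norm (f n / real n - h) < e" by blast
  qed
  then show ?thesis using that h_le by blast
qed

context finite_alphabet_shift
begin

lemma entropy_limit: "(\<lambda>n. ln (real (complexity X n)) / real n) \<longlonglongrightarrow> topological_entropy X"
  and entropy_le: "k \<ge> 1 \<Longrightarrow> topological_entropy X \<le> ln (real (complexity X k)) / real k"
proof -
  have pos: "real (complexity X n) \<ge> 1" for n using complexity_pos[of n] by simp
  have "ln (real (complexity X (m + n))) \<le> ln (real (complexity X m)) + ln (real (complexity X n))"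
    for m n
  proof -
    have "real (complexity X (m + n)) \<le> real (complexity X m) * real (complexity X n)"
      using complexity_submult[of m n] by (simp flip: of_nat_mult)
    then have "ln (real (complexity X (m + n))) \<le> ln (real (complexity X m) * real (complexity X n))"
      using pos[of "m + n"] by (intro ln_mono) auto
    then show ?thesis using pos[of m] pos[of n] by (simp add: ln_mult)
  qed
  moreover have "ln (real (complexity X n)) \<ge> 0" for n using pos[of n] by simp
  ultimately obtain h where h: "(\<lambda>n. ln (real (complexity X n)) / real n) \<longlonglongrightarrow> h"
    "\<And>k. k \<ge> 1 \<Longrightarrow> h \<le> ln (real (complexity X k)) / real k"
    using subadditive_limit[of "\<lambda>n. ln (real (complexity X n))"] by blast
  moreover have "topological_entropy X = h"
    unfolding topological_entropy_def using h(1) by (rule limI)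
  ultimately show "(\<lambda>n. ln (real (complexity X n)) / real n) \<longlonglongrightarrow> topological_entropy X"
    "k \<ge> 1 \<Longrightarrow> topological_entropy X \<le> ln (real (complexity X k)) / real k" by auto
qed

lemma entropy_nonneg: "topological_entropy X \<ge> 0"
  using entropy_limit
proof (rule LIMSEQ_le_const)
  have "0 \<le> ln (real (complexity X n)) / real n" for n using complexity_pos[of n] by simp
  then show "\<exists>N. \<forall>n\<ge>N. 0 \<le> ln (real (complexity X n)) / real n" by blast
qed

end

text \<open>After division by \<open>n\<close> the term \<open>ln c\<close> vanishes, and along the
  multiples of \<open>M\<close> the quotients for \<open>X\<close> have the same limit. Only the
  rescaling leaves a trace, the factor \<open>M\<close>.\<close>

lemma entropy_le_scaled:
  assumes X: "finite_alphabet_shift X E" and Y: "finite_alphabet_shift Y F"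
    and c: "c > 0" and M: "M \<ge> 1"
    and le: "\<forall>\<^sub>F n in sequentially. real (complexity Y n) \<le> c * real (complexity X (M * n))"
  shows "topological_entropy Y \<le> real M * topological_entropy X"
proof -
  interpret X: finite_alphabet_shift X E by fact
  interpret Y: finite_alphabet_shift Y F by fact
  let ?l = "\<lambda>n. ln (real (complexity X n)) / real n"
  have "filterlim (\<lambda>n. M * n) sequentially sequentially"
    using M by (intro filterlim_subseq) (simp add: strict_mono_def)
  then have "(\<lambda>n. ?l (M * n)) \<longlonglongrightarrow> topological_entropy X"
    using X.entropy_limit by (rule filterlim_compose[rotated])
  moreover have "(\<lambda>n. ln c / real n) \<longlonglongrightarrow> 0"
    by (rule lim_const_over_n)
  ultimately have "(\<lambda>n. ln c / real n + real M * ?l (M * n)) \<longlonglongrightarrow> 0 + real M * topological_entropy X"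
    by (intro tendsto_intros)
  moreover have "\<forall>\<^sub>F n in sequentially.
      ln (real (complexity Y n)) / real n \<le> ln c / real n + real M * ?l (M * n)"
    using le eventually_gt_at_top[of 0]
  proof eventually_elim
    case (elim n)
    have X: "real (complexity X (M * n)) > 0" using X.complexity_pos[of "M * n"] by simp
    have "ln (real (complexity Y n)) \<le> ln (c * real (complexity X (M * n)))"
      using elim(1) Y.complexity_pos[of n] by (intro ln_mono) auto
    also have "\<dots> = ln c + ln (real (complexity X (M * n)))" using c X by (simp add: ln_mult)
    finally show ?case using elim(2) M by (simp add: field_simps)
  qed
  ultimately show ?thesis
    using Y.entropy_limit by (intro tendsto_le[OF sequentially_bot]) auto
qed

lemma lamination_entropy_zero:
  assumes A: "based_group G A" and B: "based_group G B"
    and S: "generated_group G S" and L: "algebraic_lamination G S L"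
    and 0: "topological_entropy (lamination_subshift G S A L) = 0"
  shows "topological_entropy (lamination_subshift G S B L) = 0"
proof -
  note X = finite_alphabet_lamination_subshift[OF A S L]
  note Y = finite_alphabet_lamination_subshift[OF B S L]
  obtain C M :: nat where CM: "C \<ge> 1" "M \<ge> 1"
    "\<And>n. complexity (lamination_subshift G S B L) n
      \<le> C * complexity (lamination_subshift G S A L) (M * n)"
    using complexity_transfer[OF A B S L] by blast
  have "real (complexity (lamination_subshift G S B L) n)
      \<le> real C * real (complexity (lamination_subshift G S A L) (M * n))" for n
    using CM(3)[of n] by (simp flip: of_nat_mult)
  then have "topological_entropy (lamination_subshift G S B L) \<le> real M * 0"
    using entropy_le_scaled[OF X Y, of "real C" M] CM 0 by simp
  then show ?thesis using finite_alphabet_shift.entropy_nonneg[OF Y] by simp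
qed

lemma lamination_complexity_bounds:
  assumes A: "based_group G A" and B: "based_group G B"
    and S: "generated_group G S" and L: "algebraic_lamination G S L"
  shows "\<exists>c>0. \<exists>d>0. \<exists>C>0. \<exists>D>0. complexity_bounds c d C D
    (complexity (lamination_subshift G S A L)) (complexity (lamination_subshift G S B L))"
proof -
  let ?p = "complexity (lamination_subshift G S A L)" and ?q = "complexity (lamination_subshift G S B L)"
  interpret Y: finite_alphabet_shift "lamination_subshift G S B L" "letters G B"
    by (rule finite_alphabet_lamination_subshift[OF B S L])
  obtain C D :: nat where CD: "C \<ge> 1" "D \<ge> 1" "\<And>n. ?q n \<le> C * ?p (D * n)"
    using complexity_transfer[OF A B S L] by blast
  obtain C' D' :: nat where CD': "C' \<ge> 1" "D' \<ge> 1" "\<And>n. ?p n \<le> C' * ?q (D' * n)"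
    using complexity_transfer[OF B A S L] by blast
  \<comment> \<open>The lower bound is the reverse transfer at \<open>n div D'\<close>, the floor of
    \<open>n / D'\<close>, combined with \<open>D' * (n div D') \<le> n\<close> and the monotonicity
    of \<open>?q\<close>.\<close>
  have "complexity_bounds (1 / real C') (1 / real D') (real C) (real D) ?p ?q"
    unfolding complexity_bounds_def
  proof (intro always_eventually allI conjI)
    fix n
    have "nat \<lfloor>1 / real D' * real n\<rfloor> = n div D'" by (simp add: floor_divide_of_nat_eq)
    moreover have "?p (n div D') \<le> C' * ?q n"
      using CD'(3)[of "n div D'"] Y.complexity_mono[of "D' * (n div D')" n]
      by (meson mult_le_mono2 order_trans times_div_less_eq_dividend)
    then have "real (?p (n div D')) \<le> real C' * real (?q n)" by (simp flip: of_nat_mult)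
    ultimately show "1 / real C' * real (?p (nat \<lfloor>1 / real D' * real n\<rfloor>)) \<le> real (?q n)"
      using CD'(1) by (simp add: field_simps)
    have "nat \<lfloor>real D * real n\<rfloor> = D * n" by (simp flip: of_nat_mult)
    then show "real (?q n) \<le> real C * real (?p (nat \<lfloor>real D * real n\<rfloor>))"
      using CD(3)[of n] by (simp flip: of_nat_mult)
  qed
  moreover have "1 / real C' > 0" "1 / real D' > 0" "real C > 0" "real D > 0" using CD CD' by auto
  ultimately show ?thesis by blast
qed

section \<open>Laminations given by admissible pairs of letters\<close>

context based_group
begin

lemma fork_unique: "fork l r k \<Longrightarrow> fork l r k' \<Longrightarrow> k = k'"
  unfolding fork_def by (metis linorder_neqE_nat)

text \<open>
  The two rays part after \<open>k\<close> letters, and the line joining their ends reads \<open>\<dots> inv (l k), r k, \<dots>\<close>.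
  All its pairs of consecutive letters are to lie in \<open>R\<close>. As \<open>R\<close> will be closed under inversion,
  the pairs on the left half may be tested in the direction of the ray \<open>l\<close>.
\<close>
definition chain_at :: "('a \<Rightarrow> 'a \<Rightarrow> bool) \<Rightarrow> (nat \<Rightarrow> 'a) \<Rightarrow> (nat \<Rightarrow> 'a) \<Rightarrow> nat \<Rightarrow> bool"
  where "chain_at R l r k \<longleftrightarrow> (\<forall>i<k. l i = r i) \<and> R (inv (l k)) (r k) \<and>
    (\<forall>i\<ge>k. R (l i) (l (Suc i)) \<and> R (r i) (r (Suc i)))"

definition chain_lamination :: "('a \<Rightarrow> 'a \<Rightarrow> bool) \<Rightarrow> ((nat \<Rightarrow> 'a) set \<times> (nat \<Rightarrow> 'a) set) set"
  where "chain_lamination R =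
    {(ray_end l, ray_end r) | l r. ray l \<and> ray r \<and> (\<exists>k. chain_at R l r k)}"

context
  fixes R :: "'a \<Rightarrow> 'a \<Rightarrow> bool"
  assumes R_alph: "\<And>u v. R u v \<Longrightarrow> u \<in> alph \<and> v \<in> alph"
    and R_reduced: "\<And>u v. R u v \<Longrightarrow> v \<noteq> inv u"
    and R_inv: "\<And>u v. R u v \<Longrightarrow> R (inv v) (inv u)"
begin

text \<open>If the rays agreed at \<open>k\<close>, the pair at the junction would be a letter
  preceded by its inverse. So \<open>k\<close> is determined by the two rays.\<close>

lemma chain_at_fork: "ray l \<Longrightarrow> chain_at R l r k \<Longrightarrow> fork l r k"
  unfolding chain_at_def fork_def using R_reduced by (metis inv_inv alph_carrier ray_def rangeI subsetD)

lemma in_chain_lamination_iff: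
  assumes "ray l" "ray r"
  shows "(ray_end l, ray_end r) \<in> chain_lamination R \<longleftrightarrow> (\<exists>k. chain_at R l r k)"
  unfolding chain_lamination_def using assms ray_end_inj by blast

text \<open>Translation keeps the line and only changes its position relative to the base point. Off
  the line (\<open>k > 0\<close>) the distance changes by one. On the line either one ray cancels,
  the base point slides along the line and the pair that changes sides is inverted by
  \<open>R_inv\<close>, or the base point leaves the line and \<open>k\<close> becomes 1.\<close>

lemma chain_at_act:
  assumes a: "a \<in> alph" and l: "ray l" and r: "ray r" and ch: "chain_at R l r k"
  shows "\<exists>k. chain_at R (act a l) (act a r) k"
proof (cases k)
  case (Suc k')
  then have eq: "l 0 = r 0" using ch by (auto simp: chain_at_def)
  show ?thesis
  proof (cases "r 0 = inv a")
    case True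
    then have "chain_at R (act a l) (act a r) k'"
      using ch eq Suc by (auto simp: chain_at_def act_def)
    then show ?thesis ..
  next
    case False
    have "chain_at R (act a l) (act a r) (Suc k)"
      using ch eq False by (auto simp: chain_at_def act_def split: nat.split dest: Suc_le_D)
    then show ?thesis ..
  qed
next
  case 0
  have la: "l i \<in> alph" and ra: "r i \<in> alph" for i using l r by (auto simp: ray_def)
  have R0: "R (inv (l 0)) (r 0)" and Rl: "\<And>i. R (l i) (l (Suc i))" and Rr: "\<And>i. R (r i) (r (Suc i))"
    using ch 0 by (auto simp: chain_at_def)
  have "l 0 \<noteq> r 0" using chain_at_fork[OF l ch] 0 by (simp add: fork_def)
  then consider "l 0 = inv a" "r 0 \<noteq> inv a" | "r 0 = inv a" "l 0 \<noteq> inv a"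
    | "l 0 \<noteq> inv a" "r 0 \<noteq> inv a" by metis
  then show ?thesis
  proof cases
    case 1
    have "R a (r 0)" "R (inv (l 1)) a" using R0 R_inv[OF Rl[of 0]] 1 a by auto
    then have "chain_at R (act a l) (act a r) 0"
      using 1 Rl Rr by (auto simp: chain_at_def act_def split: nat.split)
    then show ?thesis ..
  next
    case 2
    have "R a (l 0)" "R (inv a) (r 1)" using R_inv[OF R0] Rr[of 0] 2 a la by auto
    then have "chain_at R (act a l) (act a r) 0"
      using 2 Rl Rr by (auto simp: chain_at_def act_def split: nat.split)
    then show ?thesis ..
  next
    case 3
    then have "chain_at R (act a l) (act a r) 1"
      using R0 Rl Rr by (auto simp: chain_at_def act_def split: nat.split)
    then show ?thesis ..
  qed
qed

lemma chain_lamination_invariant: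
  assumes "g \<in> carrier G" "(\<xi>, \<eta>) \<in> chain_lamination R"
  shows "(boundary_action G g \<xi>, boundary_action G g \<eta>) \<in> chain_lamination R"
proof -
  have "(boundary_action G (word_prod G w) \<xi>, boundary_action G (word_prod G w) \<eta>) \<in> chain_lamination R"
    if "set w \<subseteq> alph" for w
    using that
  proof (induction w)
    case Nil
    have "boundary_action G \<one> (ray_end q) = ray_end q" for q
    proof -
      have "(\<lambda>i. \<one> \<otimes> s i) = s" if "s \<in> ray_end q" for s
      proof -
        have "s i \<in> carrier G" for i using tends_carrier[of s q] that by (auto simp: ray_end_def)
        then show ?thesis by simp
      qed
      then have "(\<lambda>s i. \<one> \<otimes> s i) ` ray_end q = (\<lambda>s. s) ` ray_end q" by (intro image_cong) auto
      then show ?thesis by (simp add: boundary_action_def)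
    qed
    then show ?case using assms(2) by (auto simp: chain_lamination_def)
  next
    case (Cons a w)
    let ?h = "word_prod G w"
    have h: "?h \<in> carrier G" and a: "a \<in> alph" using Cons.prems alph_closed by auto
    have mult: "boundary_action G (a \<otimes> ?h) (ray_end q) = boundary_action G a (boundary_action G ?h (ray_end q))"
      for q
    proof -
      have "(\<lambda>i. a \<otimes> ?h \<otimes> s i) = (\<lambda>i. a \<otimes> (?h \<otimes> s i))" if "s \<in> ray_end q" for s
      proof -
        have "s i \<in> carrier G" for i using tends_carrier[of s q] that by (auto simp: ray_end_def)
        then show ?thesis using h a by (simp add: m_assoc)
      qed
      then show ?thesis unfolding boundary_action_def image_image by (intro image_cong) auto
    qed
    obtain l r k where lr: "ray l" "ray r" "chain_at R l r k"
      "boundary_action G ?h \<xi> = ray_end l" "boundary_action G ?h \<eta> = ray_end r"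
      using Cons unfolding chain_lamination_def by auto
    obtain q q' where "\<xi> = ray_end q" "\<eta> = ray_end q'"
      using assms(2) unfolding chain_lamination_def by blast
    then have "boundary_action G (a \<otimes> ?h) \<xi> = ray_end (act a l)"
      "boundary_action G (a \<otimes> ?h) \<eta> = ray_end (act a r)"
      using mult lr a boundary_action_letter by simp_all
    then show ?case
      using chain_at_act[OF a lr(1-3)] ray_act[OF a] lr in_chain_lamination_iff by simp
  qed
  from this[OF nf_alph[OF assms(1)]] show ?thesis using assms(1) by simp
qed

lemma chain_at_flip:
  assumes l: "ray l" and ch: "chain_at R l r k"
  shows "chain_at R r l k"
proof -
  have "l k \<in> alph" using l by (auto simp: ray_def)
  moreover have "R (inv (r k)) (inv (inv (l k)))" using ch R_inv by (simp add: chain_at_def)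
  ultimately show ?thesis using ch by (simp add: chain_at_def)
qed

text \<open>A forbidden pair on the line, together with the fork, is seen on finite prefixes.\<close>
lemma chain_complement_cylinder:
  assumes l: "ray l" and r: "ray r" and "l \<noteq> r" and no: "\<not> (\<exists>k. chain_at R l r k)"
  obtains n where "\<And>l' r'. ray l' \<Longrightarrow> (\<forall>i<n. l' i = l i) \<Longrightarrow> (\<forall>i<n. r' i = r i) \<Longrightarrow>
    l' \<noteq> r' \<and> \<not> (\<exists>k. chain_at R l' r' k)"
proof -
  obtain k where k: "fork l r k" using fork_exists[OF assms(3)] ..
  have "\<not> chain_at R l r k" using no by blast
  then obtain i where i: "i \<ge> k" "\<not> R (inv (l k)) (r k) \<or> \<not> R (l i) (l (Suc i)) \<or> \<not> R (r i) (r (Suc i))"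
    using k unfolding chain_at_def fork_def by blast
  have "l' \<noteq> r' \<and> \<not> (\<exists>k. chain_at R l' r' k)"
    if l': "ray l'" and eq: "\<forall>j<i + 2. l' j = l j" "\<forall>j<i + 2. r' j = r j" for l' r'
  proof -
    have f: "fork l' r' k" using k eq i(1) by (simp add: fork_def)
    have "\<not> chain_at R l' r' k" using i eq by (auto simp: chain_at_def)
    then have "\<not> chain_at R l' r' k'" for k'
      using chain_at_fork[OF l'] fork_unique[OF f] by blast
    then show ?thesis using f by (auto simp: fork_def)
  qed
  then show ?thesis using that by blast
qed

lemma algebraic_lamination_chain:
  assumes S: "generated_group G S" and ne: "chain_lamination R \<noteq> {}"
  shows "algebraic_lamination G S (chain_lamination R)"
  unfolding algebraic_lamination_def
proof (intro conjI ne)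
  let ?T = "prod_topology (boundary_topology G S) (boundary_topology G S)"
  let ?D = "double_boundary G S"
  have "ray_end l \<noteq> ray_end r" if "ray l" "chain_at R l r k" for l r k
    using chain_at_fork[OF that] ray_end_inj[OF that(1), of r] by (auto simp: fork_def)
  then have sub: "chain_lamination R \<subseteq> ?D"
    unfolding chain_lamination_def double_boundary_def gromov_boundary_eq[OF S] by auto
  \<comment> \<open>Open even in the full product, since the boxes found below contain only pairs of
    distinct ends.\<close>
  have "openin ?T (?D - chain_lamination R)"
    unfolding openin_prod_topology_alt
  proof (intro allI impI)
    fix \<xi> \<eta> assume "(\<xi>, \<eta>) \<in> ?D - chain_lamination R"
    then obtain l r where lr: "ray l" "ray r" "\<xi> = ray_end l" "\<eta> = ray_end r" "l \<noteq> r"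
      and "(ray_end l, ray_end r) \<notin> chain_lamination R"
      unfolding double_boundary_def gromov_boundary_eq[OF S] by auto
    then have "\<not> (\<exists>k. chain_at R l r k)" using in_chain_lamination_iff by simp
    then obtain n where n: "\<And>l' r'. ray l' \<Longrightarrow> (\<forall>i<n. l' i = l i) \<Longrightarrow> (\<forall>i<n. r' i = r i) \<Longrightarrow>
        l' \<noteq> r' \<and> \<not> (\<exists>k. chain_at R l' r' k)"
      using chain_complement_cylinder[OF lr(1,2,5)] by blast
    define U where "U q = {ray_end q' | q'. ray q' \<and> (\<forall>i<n. q' i = q i)}" for q
    have "openin (boundary_topology G S) (U q)" for q
      unfolding openin_boundary_topology U_def by (rule boundary_open_cylinder[OF S])
    moreover have "\<xi> \<in> U l" "\<eta> \<in> U r" using lr unfolding U_def by auto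
    moreover have "U l \<times> U r \<subseteq> ?D - chain_lamination R"
    proof
      fix z assume "z \<in> U l \<times> U r"
      then obtain l' r' where z: "z = (ray_end l', ray_end r')" "ray l'" "ray r'"
        "\<forall>i<n. l' i = l i" "\<forall>i<n. r' i = r i"
        unfolding U_def by auto
      then have "l' \<noteq> r'" "\<not> (\<exists>k. chain_at R l' r' k)" using n by blast+
      then show "z \<in> ?D - chain_lamination R"
        using z in_chain_lamination_iff[OF z(2,3)] ray_end_inj[OF z(2)]
        unfolding double_boundary_def gromov_boundary_eq[OF S] by auto
    qed
    ultimately show "\<exists>U V. openin (boundary_topology G S) U \<and> openin (boundary_topology G S) V \<and>
        \<xi> \<in> U \<and> \<eta> \<in> V \<and> U \<times> V \<subseteq> ?D - chain_lamination R" by blast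
  qed
  moreover have "topspace (subtopology ?T ?D) = ?D"
    by (auto simp: topspace_boundary_topology double_boundary_def)
  ultimately show "closedin (subtopology ?T ?D) (chain_lamination R)"
    unfolding closedin_def using sub by (auto simp: openin_subtopology)
  show "\<forall>g\<in>carrier G. \<forall>(\<xi>, \<eta>)\<in>chain_lamination R.
      (boundary_action G g \<xi>, boundary_action G g \<eta>) \<in> chain_lamination R"
    using chain_lamination_invariant by blast
  show "\<forall>(\<xi>, \<eta>)\<in>chain_lamination R. (\<eta>, \<xi>) \<in> chain_lamination R"
    unfolding chain_lamination_def using chain_at_flip by blast
qed

text \<open>The two rays of a biinfinite reduced word part at 0, so the chain condition holds there.
  On the left half it is stated outwards, and \<open>R_inv\<close> turns it back into reading
  direction.\<close>

lemma chain_subshift_consecutive: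
  assumes S: "generated_group G S" and y: "y \<in> lamination_subshift G S A (chain_lamination R)"
  shows "R (y j) (y (j + 1))"
proof -
  have yr: "y \<in> reduced_biinfinite G A" and yL: "(ray_end (left_ray y), ray_end (right_ray y)) \<in> chain_lamination R"
    using y unfolding in_lamination_subshift_iff[OF S] by blast+
  have a: "y i \<in> alph" for i using yr unfolding reduced_biinfinite_def by blast
  note rays = rays_of_biinfinite[OF yr]
  obtain k where k: "chain_at R (left_ray y) (right_ray y) k"
    using yL in_chain_lamination_iff[OF rays(1,2)] by blast
  have "fork (left_ray y) (right_ray y) 0" using rays(3) by (simp add: fork_def)
  then have "k = 0" using chain_at_fork[OF rays(1) k] fork_unique by blast
  then have R0: "R (inv (inv (y 0))) (y 1)"
    and Rl: "\<And>i. R (inv (y (- int i))) (inv (y (- int (Suc i))))"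
    and Rr: "\<And>i. R (y (int i + 1)) (y (int (Suc i) + 1))"
    using k by (simp_all add: chain_at_def)
  consider "j = 0" | "j \<ge> 1" | "j \<le> -1" by linarith
  then show ?thesis
  proof cases
    case 1
    then show ?thesis using R0 a by simp
  next
    case 2
    then show ?thesis using Rr[of "nat (j - 1)"] by (simp add: add.commute)
  next
    case 3
    define i where "i = nat (- j - 1)"
    have j: "- int i = j + 1" "- int (Suc i) = j" using 3 by (auto simp: i_def)
    show ?thesis using R_inv[OF Rl[of i]] a unfolding j by simp
  qed
qed

end

end

section \<open>Automorphisms and bases\<close>

text \<open>An automorphism commutes with inversion and is injective, so it matches reduced words
  over \<open>A\<close> with those over the image, and it intertwines the two product maps.\<close>

lemma (in group) free_basis_image:
  assumes phi: "\<phi> \<in> iso G G" and A: "free_basis G A"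
  shows "free_basis G (\<phi> ` A)"
proof -
  interpret A: based_group G A by standard (fact A)
  have bij: "bij_betw \<phi> (carrier G) (carrier G)" and hom: "\<phi> \<in> hom G G"
    using phi by (auto simp: iso_def)
  interpret phi: group_hom G G \<phi> using hom by unfold_locales
  have inj: "\<phi> x = \<phi> y \<longleftrightarrow> x = y" if "x \<in> carrier G" "y \<in> carrier G" for x y
    using bij that by (auto simp: bij_betw_def inj_on_def)
  have inv_image: "(\<lambda>a. inv a) ` \<phi> ` A = \<phi> ` (\<lambda>a. inv a) ` A"
    using A.basis_closed by (force simp: image_iff)
  then have letters: "letters G (\<phi> ` A) = \<phi> ` letters G A"
    by (simp add: letters_def image_Un)
  have prod: "word_prod G (map \<phi> w) = \<phi> (word_prod G w)" if "set w \<subseteq> carrier G" for w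
    using that by (induction w) auto
  have succ: "successively (\<lambda>a b. b \<noteq> inv a) (map \<phi> w) \<longleftrightarrow> successively (\<lambda>a b. b \<noteq> inv a) w"
    if "set w \<subseteq> carrier G" for w
  proof -
    have "\<phi> b \<noteq> inv (\<phi> a) \<longleftrightarrow> b \<noteq> inv a" if "a \<in> carrier G" "b \<in> carrier G" for a b
      using that inj[of b "inv a"] by simp
    then show ?thesis
      using that by (simp only: successively_map) (intro successively_cong refl, auto)
  qed
  have red: "reduced_words G (\<phi> ` A) = map \<phi> ` reduced_words G A"
  proof
    show "map \<phi> ` reduced_words G A \<subseteq> reduced_words G (\<phi> ` A)"
      using succ A.redw_carrier unfolding reduced_words_def letters by force
    show "reduced_words G (\<phi> ` A) \<subseteq> map \<phi> ` reduced_words G A"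
    proof
      fix v assume v: "v \<in> reduced_words G (\<phi> ` A)"
      then have "v \<in> lists (\<phi> ` letters G A)" by (auto simp: reduced_words_def letters)
      then obtain w where w: "v = map \<phi> w" "set w \<subseteq> letters G A"
        by (auto simp: lists_image in_lists_conv_set)
      moreover have "set w \<subseteq> carrier G" using w A.alph_closed by auto
      ultimately show "v \<in> map \<phi> ` reduced_words G A"
        using v succ by (auto simp: reduced_words_def)
    qed
  qed
  have "bij_betw (\<phi> \<circ> word_prod G) (reduced_words G A) (carrier G)"
    using A.basis_bij bij by (rule bij_betw_trans)
  then have "bij_betw (\<lambda>w. word_prod G (map \<phi> w)) (reduced_words G A) (carrier G)"
    by (rule bij_betw_cong[THEN iffD1, rotated]) (use prod A.redw_carrier in auto)
  then have "bij_betw (word_prod G) (map \<phi> ` reduced_words G A) (carrier G)"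
    by (auto simp: bij_betw_def inj_on_def image_image)
  then have "bij_betw (word_prod G) (reduced_words G (\<phi> ` A)) (carrier G)" by (simp add: red)
  moreover have "\<phi> ` A \<subseteq> carrier G" using A.basis_closed by auto
  moreover have "\<phi> ` A \<inter> (\<lambda>a. inv a) ` \<phi> ` A = {}"
  proof -
    have "\<phi> a \<noteq> \<phi> (inv b)" if "a \<in> A" "b \<in> A" for a b
      using that A.basis_inv_notin[OF that] inj[of a "inv b"] A.basis_closed by auto
    then show ?thesis unfolding inv_image by auto
  qed
  ultimately show ?thesis by (simp add: free_basis_def)
qed

context based_group
begin

definition letter_map :: "('a \<Rightarrow> 'a) \<Rightarrow> 'a \<Rightarrow> 'a"
  where "letter_map f c = (if c \<in> A then f c else inv (f (inv c)))"

text \<open>The endomorphism provided by the universal property of the free group, with values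
  \<open>f\<close> on the basis.\<close>

definition extension :: "('a \<Rightarrow> 'a) \<Rightarrow> 'a \<Rightarrow> 'a"
  where "extension f g = word_prod G (map (letter_map f) (nf g))"

context
  fixes f
  assumes f: "f \<in> A \<rightarrow> carrier G"
begin

lemma letter_map_closed: "c \<in> alph \<Longrightarrow> letter_map f c \<in> carrier G"
  using f basis_closed by (auto simp: letter_map_def letters_def)

lemma letter_map_inv: "c \<in> alph \<Longrightarrow> letter_map f (inv c) = inv (letter_map f c)"
proof -
  assume "c \<in> alph"
  then consider "c \<in> A" | b where "b \<in> A" "c = inv b" by (auto simp: letters_def)
  then show ?thesis
  proof cases
    case 1
    then have "inv c \<notin> A" using basis_inv_notin by blast
    then show ?thesis using 1 f basis_closed by (auto simp: letter_map_def)
  next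
    case 2
    then have "inv b \<notin> A" "f b \<in> carrier G" "b \<in> carrier G"
      using basis_inv_notin f basis_closed by auto
    then show ?thesis using 2 by (simp add: letter_map_def)
  qed
qed

lemma letter_map_word_closed: "set w \<subseteq> alph \<Longrightarrow> set (map (letter_map f) w) \<subseteq> carrier G"
  using letter_map_closed by auto

lemma extension_closed: "g \<in> carrier G \<Longrightarrow> extension f g \<in> carrier G"
  unfolding extension_def by (intro word_prod_closed letter_map_word_closed nf_alph)

lemma extension_letter_mult:
  assumes c: "c \<in> alph" and g: "g \<in> carrier G"
  shows "extension f (c \<otimes> g) = letter_map f c \<otimes> extension f g"
proof (cases "nf g \<noteq> [] \<and> hd (nf g) = inv c")
  case True
  then obtain w where w: "nf g = inv c # w" by (cases "nf g") auto
  then have "set w \<subseteq> alph" using nf_alph[OF g] by simp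
  then have "word_prod G (map (letter_map f) w) \<in> carrier G"
    by (intro word_prod_closed letter_map_word_closed)
  then show ?thesis
    using w c letter_map_closed[OF c] nf_mult_letter[OF c g]
    by (simp add: extension_def letter_map_inv mult_inv_cancel_left)
next
  case False
  then have "nf (c \<otimes> g) = c # nf g" using nf_mult_letter[OF c g] by auto
  then show ?thesis by (simp add: extension_def)
qed

lemma extension_basis: "a \<in> A \<Longrightarrow> extension f a = f a"
  using funcset_mem[OF f] by (simp add: extension_def nf_letter letter_map_def)

lemma extension_hom: "extension f \<in> hom G G"
proof (rule homI)
  fix g h assume g: "g \<in> carrier G" and h: "h \<in> carrier G"
  have "extension f (word_prod G w \<otimes> h) = word_prod G (map (letter_map f) w) \<otimes> extension f h"
    if "set w \<subseteq> alph" for w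
    using that
  proof (induction w)
    case Nil
    then show ?case using h extension_closed by simp
  next
    case (Cons c w)
    have w: "set w \<subseteq> carrier G" "c \<in> alph" "c \<in> carrier G" using Cons.prems alph_closed by auto
    have "word_prod G (map (letter_map f) w) \<in> carrier G"
      using Cons.prems by (intro word_prod_closed letter_map_word_closed) simp
    then show ?case
      using Cons w h letter_map_closed extension_closed
      by (simp add: m_assoc extension_letter_mult)
  qed
  from this[OF nf_alph[OF g]] show "extension f (g \<otimes> h) = extension f g \<otimes> extension f h"
    using g by (simp add: extension_def)
qed (rule extension_closed)

end

lemma hom_fixing_basis:
  assumes H: "H \<in> hom G G" and fixed: "\<And>a. a \<in> A \<Longrightarrow> H a = a" and g: "g \<in> carrier G"
  shows "H g = g"
proof -
  interpret H: group_hom G G H using H by unfold_locales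
  have alph: "H c = c" if "c \<in> alph" for c
    using that fixed basis_closed by (auto simp: letters_def)
  have "H (word_prod G w) = word_prod G w" if "set w \<subseteq> alph" for w
    using that
  proof (induction w)
    case (Cons c w)
    then have "c \<in> alph" "set w \<subseteq> carrier G" using alph_closed by auto
    then show ?case using Cons alph by simp
  qed simp
  from this[OF nf_alph[OF g]] show ?thesis using g by simp
qed

text \<open>The Nielsen map sending \<open>b\<close> to \<open>a \<otimes> b\<close> and fixing the
  other basis elements is inverted by sending \<open>b\<close> to \<open>inv a \<otimes> b\<close>:
  both composites fix the basis. So it is an automorphism, and it carries \<open>A\<close> to a
  basis.\<close>

lemma nielsen_basis:
  assumes ab: "a \<in> A" "b \<in> A" "a \<noteq> b"
  shows "\<exists>A'. free_basis G A' \<and> a \<in> A' \<and> a \<otimes> b \<in> A'"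
proof -
  define f f' where "f = (\<lambda>x. if x = b then a \<otimes> b else x)" and "f' = (\<lambda>x. if x = b then inv a \<otimes> b else x)"
  have c: "a \<in> carrier G" "b \<in> carrier G" using ab basis_closed by auto
  have f: "f \<in> A \<rightarrow> carrier G" "f' \<in> A \<rightarrow> carrier G"
    using ab c basis_closed by (auto simp: f_def f'_def)
  note hom = extension_hom[OF f(1)] extension_hom[OF f(2)]
  note ext = extension_basis[OF f(1)] extension_basis[OF f(2)]
  have "inv a \<in> carrier G" using c by simp
  interpret h: group_hom G G "extension f" using hom(1) by unfold_locales
  interpret h': group_hom G G "extension f'" using hom(2) by unfold_locales
  have fb: "extension f b = a \<otimes> b" "extension f' b = inv a \<otimes> b"
    using ext ab by (simp_all add: f_def f'_def)
  have fx: "extension f x = x" "extension f' x = x" if "x \<in> A" "x \<noteq> b" for x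
    using ext that by (simp_all add: f_def f'_def)
  have "extension f' (extension f x) = x \<and> extension f (extension f' x) = x" if "x \<in> A" for x
    using that fx[OF ab(1,3)] fx[of x] fb c
    by (cases "x = b") (simp_all add: inv_mult_cancel_left mult_inv_cancel_left)
  moreover have "extension f' \<circ> extension f \<in> hom G G" "extension f \<circ> extension f' \<in> hom G G"
    by (auto intro!: homI)
  ultimately have "extension f' (extension f g) = g" "extension f (extension f' g) = g"
    if "g \<in> carrier G" for g
    using hom_fixing_basis[of "extension f' \<circ> extension f" g]
      hom_fixing_basis[of "extension f \<circ> extension f'" g] that
    by auto
  then have "bij_betw (extension f) (carrier G) (carrier G)"
    by (intro bij_betw_byWitness[where f' = "extension f'"]) auto
  then have "extension f \<in> iso G G" using hom by (simp add: iso_def)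
  then have "free_basis G (extension f ` A)" using basis by (rule free_basis_image)
  moreover have "extension f a = a" "extension f b = a \<otimes> b" using ext ab by (simp_all add: f_def)
  then have "a \<in> extension f ` A" "a \<otimes> b \<in> extension f ` A" using ab by (metis image_eqI)+
  ultimately show ?thesis by blast
qed

end

section \<open>An example with different entropies\<close>

context based_group
begin

text \<open>The transitions of the golden mean shift, in which \<open>b\<close> never follows
  \<open>b\<close>.\<close>

definition positive_pairs :: "'a \<Rightarrow> 'a \<Rightarrow> ('a \<times> 'a) set"
  where "positive_pairs a b = {(a, a), (a, b), (b, a)}"

definition negative_pairs :: "'a \<Rightarrow> 'a \<Rightarrow> ('a \<times> 'a) set"
  where "negative_pairs a b = {(inv a, inv a), (inv a, inv b), (inv b, inv a)}"

definition golden :: "'a \<Rightarrow> 'a \<Rightarrow> 'a \<Rightarrow> 'a \<Rightarrow> bool"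
  where "golden a b u v \<longleftrightarrow> (u, v) \<in> positive_pairs a b \<union> negative_pairs a b"

lemmas golden_defs = golden_def positive_pairs_def negative_pairs_def

context
  fixes a b
  assumes ab: "a \<in> A" "b \<in> A" "a \<noteq> b"
begin

lemma golden_carrier: "a \<in> carrier G" "b \<in> carrier G"
  using ab basis_closed by auto

lemma golden_neq: "a \<noteq> inv a" "a \<noteq> inv b" "b \<noteq> inv a" "b \<noteq> inv b"
  using ab basis_inv_notin by auto

lemma golden_alph: "golden a b u v \<Longrightarrow> u \<in> alph \<and> v \<in> alph"
  using ab by (auto simp: golden_defs)

lemma golden_reduced: "golden a b u v \<Longrightarrow> v \<noteq> inv u"
  using golden_neq golden_carrier by (auto simp: golden_defs)

lemma golden_inv: "golden a b u v \<Longrightarrow> golden a b (inv v) (inv u)"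
  using golden_carrier by (auto simp: golden_defs)

text \<open>No transition leads from \<open>a\<close>, \<open>b\<close> to their inverses, so the
  sign is constant along a line. The two signs are the source of the factor 2 in the count of
  words.\<close>

lemma golden_positive: "(u, v) \<in> positive_pairs a b \<Longrightarrow> golden a b v w \<Longrightarrow> (v, w) \<in> positive_pairs a b"
  using golden_neq by (auto simp: golden_defs)

lemma golden_negative: "(u, v) \<in> negative_pairs a b \<Longrightarrow> golden a b v w \<Longrightarrow> (v, w) \<in> negative_pairs a b"
  using golden_neq by (auto simp: golden_defs)

definition golden_lamination :: "((nat \<Rightarrow> 'a) set \<times> (nat \<Rightarrow> 'a) set) set"
  where "golden_lamination = chain_lamination (golden a b)"

text \<open>A word of length 6 is cut into three disjoint pairs, all of the same sign, with three
  choices each. Length 6 is the first even length at which this crude bound is below the full count: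
  \<open>2 * 3 > 4\<close> and \<open>2 * 9 > 16\<close>, but \<open>2 * 27 < 64\<close>.\<close>

lemma golden_subshift_complexity:
  assumes S: "generated_group G S"
  shows "complexity (lamination_subshift G S A golden_lamination) 6 \<le> 54"
proof -
  let ?P = "positive_pairs a b" and ?N = "negative_pairs a b"
  define f :: "('a \<times> 'a) \<times> ('a \<times> 'a) \<times> ('a \<times> 'a) \<Rightarrow> 'a list"
    where "f = (\<lambda>((p, q), (r, s), (t, u)). [p, q, r, s, t, u])"
  have sub: "words (lamination_subshift G S A golden_lamination) 6 \<subseteq> f ` (?P \<times> ?P \<times> ?P \<union> ?N \<times> ?N \<times> ?N)"
  proof
    fix w assume "w \<in> words (lamination_subshift G S A golden_lamination) 6"
    then obtain y k where y: "y \<in> lamination_subshift G S A (chain_lamination (golden a b))"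
      and w: "w = map (\<lambda>i. y (k + int i)) [0..<6]"
      unfolding words_eq golden_lamination_def by blast
    have step: "golden a b (y j) (y (j + 1))" for j
      using golden_alph golden_reduced golden_inv S y by (rule chain_subshift_consecutive)
    have step2: "golden a b (y (j + 1)) (y (j + 2))" for j
      using step[of "j + 1"] by (simp add: add.assoc)
    have pos: "(y (j + 1), y (j + 2)) \<in> ?P" if "(y j, y (j + 1)) \<in> ?P" for j
      using that step2 by (rule golden_positive)
    have neg: "(y (j + 1), y (j + 2)) \<in> ?N" if "(y j, y (j + 1)) \<in> ?N" for j
      using that step2 by (rule golden_negative)
    have "w = f ((y k, y (k + 1)), (y (k + 2), y (k + 3)), (y (k + 4), y (k + 5)))"
      unfolding w f_def by (simp add: upt_rec)
    moreover have "(y k, y (k + 1)) \<in> ?P \<and> (y (k + 2), y (k + 3)) \<in> ?P \<and> (y (k + 4), y (k + 5)) \<in> ?P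
      \<or> (y k, y (k + 1)) \<in> ?N \<and> (y (k + 2), y (k + 3)) \<in> ?N \<and> (y (k + 4), y (k + 5)) \<in> ?N"
      using step[of k] pos[of k] pos[of "k + 1"] pos[of "k + 2"] pos[of "k + 3"]
        neg[of k] neg[of "k + 1"] neg[of "k + 2"] neg[of "k + 3"]
      by (auto simp: golden_def add.assoc)
    ultimately show "w \<in> f ` (?P \<times> ?P \<times> ?P \<union> ?N \<times> ?N \<times> ?N)" by blast
  qed
  have "card ?P \<le> 3" "card ?N \<le> 3"
    using card_length[of "[(a, a), (a, b), (b, a)]"]
      card_length[of "[(inv a, inv a), (inv a, inv b), (inv b, inv a)]"]
    by (simp_all add: positive_pairs_def negative_pairs_def)
  moreover have "m * (m * m) \<le> 27" if "m \<le> 3" for m :: nat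
    using mult_le_mono[OF that mult_le_mono[OF that that]] by simp
  ultimately have "card ?P * (card ?P * card ?P) \<le> 27" "card ?N * (card ?N * card ?N) \<le> 27"
    by blast+
  then have "card (?P \<times> ?P \<times> ?P) + card (?N \<times> ?N \<times> ?N) \<le> 54"
    by (simp add: card_cartesian_product)
  then have "card (?P \<times> ?P \<times> ?P \<union> ?N \<times> ?N \<times> ?N) \<le> 54"
    using card_Un_le order_trans by blast
  moreover have "finite (?P \<times> ?P \<times> ?P \<union> ?N \<times> ?N \<times> ?N)"
    by (simp add: positive_pairs_def negative_pairs_def)
  ultimately show ?thesis
    unfolding complexity_words using surj_card_le[OF _ sub] order_trans by blast
qed

section \<open>The same lamination read in the letters \<open>a\<close> and
  \<open>a \<otimes> b\<close>\<close>

definition substitute :: "'a list \<Rightarrow> 'a list"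
  where "substitute w = concat (map (\<lambda>c. if c = a then [a] else [a, b]) w)"

text \<open>Each block begins with \<open>a\<close>, so no \<open>b\<close> follows a
  \<open>b\<close>; the claim about the head carries this through the induction. The trailing
  letters \<open>a\<close> allow the word to be continued to a ray.\<close>

lemma substitute_chain:
  "successively (golden a b) (substitute w @ replicate n a) \<and>
    (substitute w @ replicate n a \<noteq> [] \<longrightarrow> hd (substitute w @ replicate n a) = a)"
proof (induction w)
  case Nil
  show ?case
  proof (induction n)
    case (Suc n)
    then show ?case by (auto simp: substitute_def successively_Cons golden_defs)
  qed (simp add: substitute_def)
next
  case (Cons c w)
  then show ?case by (auto simp: substitute_def successively_Cons golden_defs)
qed

lemma word_prod_substitute:
  "set w \<subseteq> {a, a \<otimes> b} \<Longrightarrow> word_prod G (substitute w) = word_prod G w"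
proof (induction w)
  case (Cons c w)
  have "set w \<subseteq> carrier G" using Cons.prems golden_carrier by auto
  then have "word_prod G w \<in> carrier G" by simp
  then show ?case
    using Cons golden_carrier by (auto simp: substitute_def m_assoc)
qed (simp add: substitute_def)

text \<open>Both spellings end in the constant letter \<open>a\<close>, so from the end of the
  finite part on their prefixes run through the same group elements: length
  \<open>length w + m\<close> in one corresponds to \<open>length v + m\<close> in the
  other.\<close>

lemma golden_rays:
  assumes w: "set w \<subseteq> {a, a \<otimes> b}"
  obtains r where "(ray_end (\<lambda>_. inv a), ray_end r) \<in> golden_lamination"
    "ray r" "tends (\<lambda>m. word_prod G (map (\<lambda>i. if i < length w then w ! i else a) [0..<m])) r"
proof -
  define v where "v = substitute w"
  define x r where "x i = (if i < length w then w ! i else a)"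
    and "r i = (if i < length v then v ! i else a)" for i
  have x: "map x [0..<length w + m] = w @ replicate m a" for m
    by (rule nth_equalityI) (auto simp: x_def nth_append)
  have rv: "map r [0..<length v + m] = v @ replicate m a" for m
    by (rule nth_equalityI) (auto simp: r_def nth_append)
  have chain: "golden a b (r i) (r (Suc i))" for i
  proof -
    have "successively (golden a b) (map r [0..<length v + Suc (Suc i)])"
      unfolding rv using substitute_chain[of w "Suc (Suc i)"] unfolding v_def by blast
    then show ?thesis
      using successively_nth[of "golden a b" "map r [0..<length v + Suc (Suc i)]" i]
      by (simp del: upt_Suc add_Suc_right)
  qed
  have "ray r" unfolding ray_def
    using golden_alph[OF chain] golden_reduced[OF chain] by blast
  \<comment> \<open>The left ray consists of \<open>inv a\<close>, so the junction reads
    \<open>a\<close>, \<open>a\<close>, which is admissible.\<close>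
  have "r 0 = a"
  proof -
    have "v @ replicate (Suc 0) a \<noteq> []" by simp
    then have "hd (v @ replicate (Suc 0) a) = a"
      unfolding v_def using substitute_chain[of w "Suc 0"] by blast
    then show ?thesis by (cases v) (auto simp: r_def)
  qed
  have "ray (\<lambda>_. inv a)"
    using ab golden_neq golden_carrier by (auto simp: ray_def)
  moreover have "chain_at (golden a b) (\<lambda>_. inv a) r 0"
    unfolding chain_at_def
    using chain golden_carrier \<open>r 0 = a\<close> by (auto simp: golden_defs)
  ultimately have "(ray_end (\<lambda>_. inv a), ray_end r) \<in> golden_lamination"
    unfolding golden_lamination_def
    using in_chain_lamination_iff[where R = "golden a b", OF golden_alph golden_reduced golden_inv] \<open>ray r\<close> by blast
  moreover have "tends (\<lambda>m. word_prod G (map x [0..<m])) r"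
    unfolding tends_def eventually_sequentially
  proof (intro conjI allI)
    have wc: "set w \<subseteq> carrier G" "set v \<subseteq> carrier G"
      using w golden_carrier by (auto simp: v_def substitute_def)
    then have "x i \<in> carrier G" for i
      using golden_carrier nth_mem[of i w] subsetD[OF wc(1)] by (simp add: x_def)
    then have "word_prod G (map x [0..<m]) \<in> carrier G" for m by (intro word_prod_closed) auto
    then show "range (\<lambda>m. word_prod G (map x [0..<m])) \<subseteq> carrier G" by blast
    have eq: "word_prod G (map x [0..<length w + m]) = ray_prefix r (length v + m)" for m
    proof -
      have rep: "set (replicate m a) \<subseteq> carrier G" using golden_carrier by auto
      show ?thesis
        unfolding x rv word_prod_append[OF wc(1) rep] word_prod_append[OF wc(2) rep]
        using word_prod_substitute[OF w] by (simp add: v_def)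
    qed
    fix n
    have "take n (nf (word_prod G (map x [0..<i]))) = map r [0..<n]" if "i \<ge> length w + n" for i
    proof -
      define m where "m = i - length w"
      have "i = length w + m" "m \<ge> n" using that by (auto simp: m_def)
      then show ?thesis using eq[of m] nf_ray_prefix[OF \<open>ray r\<close>] by (simp add: take_map)
    qed
    then show "\<exists>N. \<forall>i\<ge>N. take n (nf (word_prod G (map x [0..<i]))) = map r [0..<n]" by blast
  qed
  ultimately show ?thesis using that \<open>ray r\<close> unfolding x_def by blast
qed

lemma algebraic_lamination_golden:
  assumes S: "generated_group G S"
  shows "algebraic_lamination G S golden_lamination"
proof -
  \<comment> \<open>The empty word yields the line with constant letter \<open>a\<close>, so the
    lamination is not empty.\<close>
  obtain r where "(ray_end (\<lambda>_. inv a), ray_end r) \<in> golden_lamination"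
    using golden_rays[of "[]"] by auto
  then have "chain_lamination (golden a b) \<noteq> {}" unfolding golden_lamination_def by auto
  then show ?thesis
    unfolding golden_lamination_def
    using algebraic_lamination_chain[where R = "golden a b", OF golden_alph golden_reduced golden_inv S] by blast
qed

text \<open>Surrounding \<open>w\<close> by \<open>a\<close> gives a biinfinite word without inverse
  letters, hence reduced over \<open>A'\<close>. Its right end was computed in
  \<open>golden_rays\<close>, and its left end is the ray with constant letter \<open>inv a\<close>
  in both spellings.\<close>

lemma golden_words:
  assumes S: "generated_group G S" and A': "free_basis G A'" "a \<in> A'" "a \<otimes> b \<in> A'"
    and w: "set w \<subseteq> {a, a \<otimes> b}" "length w = n"
  shows "w \<in> words (lamination_subshift G S A' golden_lamination) n"
proof -
  interpret A': based_group G A' by standard (fact A'(1))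
  obtain r where r: "(ray_end (\<lambda>_. inv a), ray_end r) \<in> golden_lamination" "ray r"
    "tends (\<lambda>m. word_prod G (map (\<lambda>i. if i < length w then w ! i else a) [0..<m])) r"
    using golden_rays[OF w(1)] .
  define x where "x j = (if 1 \<le> j \<and> nat (j - 1) < n then w ! nat (j - 1) else a)" for j
  have "set w \<subseteq> A'" using w(1) A' by auto
  then have "x j \<in> A'" for j
    using w(2) nth_mem[of "nat (j - 1)" w] subsetD[of "set w" A'] A' by (simp add: x_def)
  then have "x \<in> reduced_biinfinite G A'"
    unfolding reduced_biinfinite_def using A'.basis_inv_notin by auto
  moreover have "(\<lambda>i. inv (x (- int i))) = (\<lambda>_. inv a)" by (auto simp: x_def)
  moreover have "ray (\<lambda>_. inv a)"
    using ab golden_neq golden_carrier by (auto simp: ray_def)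
  moreover have "(\<lambda>i. x (int i + 1)) = (\<lambda>i. if i < length w then w ! i else a)"
    using w(2) by (auto simp: x_def)
  then have "word_endpoint G S (\<lambda>i. x (int i + 1)) = ray_end r"
    unfolding word_endpoint_def using boundary_point_eq[OF S r(3)] by simp
  ultimately have "x \<in> lamination_subshift G S A' golden_lamination"
    unfolding lamination_subshift_def endpoint_pair_def using r(1) word_endpoint_ray[OF S] by simp
  moreover have "w = map (\<lambda>i. x (1 + int i)) [0..<n]"
    using w(2) by (intro nth_equalityI) (auto simp: x_def)
  ultimately show ?thesis unfolding words_eq by blast
qed

end

lemma entropy_gap:
  assumes S: "generated_group G S" and ab: "a \<in> A" "b \<in> A" "a \<noteq> b"
  shows "\<exists>A' L. free_basis G A' \<and> algebraic_lamination G S L \<and>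
    topological_entropy (lamination_subshift G S A L) < topological_entropy (lamination_subshift G S A' L)"
proof -
  obtain A' where A': "free_basis G A'" "a \<in> A'" "a \<otimes> b \<in> A'" using nielsen_basis[OF ab] by blast
  define L where "L = golden_lamination a b"
  have L: "algebraic_lamination G S L" unfolding L_def by (rule algebraic_lamination_golden[OF ab S])
  let ?X = "lamination_subshift G S A' L" and ?Y = "lamination_subshift G S A L"
  have A: "based_group G A" and A'g: "based_group G A'" using A' by (unfold_locales)
  interpret X: finite_alphabet_shift ?X "letters G A'" by (rule finite_alphabet_lamination_subshift[OF A'g S L])
  interpret Y: finite_alphabet_shift ?Y "letters G A" by (rule finite_alphabet_lamination_subshift[OF A S L])
  have "a \<noteq> a \<otimes> b"
  proof
    have c: "a \<in> carrier G" "b \<in> carrier G" using ab basis_closed by auto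
    assume "a = a \<otimes> b"
    then have "b = \<one>" using c by (metis l_cancel_one')
    then show False using nf_letter[of b] ab by simp
  qed
  have "2 ^ n \<le> complexity ?X n" for n
  proof -
    have "card {w. set w \<subseteq> {a, a \<otimes> b} \<and> length w = n} = 2 ^ n"
      using \<open>a \<noteq> a \<otimes> b\<close> by (subst card_lists_length_eq) (auto simp: numeral_2_eq_2)
    moreover have sub: "{w. set w \<subseteq> {a, a \<otimes> b} \<and> length w = n} \<subseteq> words ?X n"
    proof clarify
      fix w assume "set w \<subseteq> {a, a \<otimes> b}" "n = length w"
      then show "w \<in> words ?X (length w)"
        unfolding L_def by (intro golden_words[OF ab S A']) auto
    qed
    ultimately show ?thesis
      unfolding complexity_words using card_mono[OF X.finite_words sub] by simp
  qed
  then have pow: "(2::real) ^ n \<le> real (complexity ?X n)" for n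
    by (metis of_nat_le_iff of_nat_numeral of_nat_power)
  have "ln 2 \<le> ln (real (complexity ?X n)) / real n" if "n \<ge> 1" for n
  proof -
    have "ln ((2::real) ^ n) \<le> ln (real (complexity ?X n))" using pow[of n] by (intro ln_mono) auto
    then show ?thesis using that by (simp add: ln_realpow field_simps)
  qed
  then have "ln 2 \<le> topological_entropy ?X"
    by (intro LIMSEQ_le_const[OF X.entropy_limit]) blast
  moreover have "topological_entropy ?Y \<le> ln (real (complexity ?Y 6)) / real 6"
    by (rule Y.entropy_le) simp
  moreover have "real (complexity ?Y 6) < 2 ^ 6"
    using golden_subshift_complexity[OF ab S] unfolding L_def by simp
  then have "ln (real (complexity ?Y 6)) < ln (2 ^ 6)"
    using Y.complexity_pos[of 6] by (intro ln_less_cancel_iff[THEN iffD2]) auto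
  then have "ln (real (complexity ?Y 6)) / real 6 < ln 2" using ln_realpow[of 2 6] by simp
  ultimately show ?thesis using A' L by (intro exI[of _ A'] exI[of _ L]) simp
qed

end

text \<open>Domination without rescaling the argument is the case \<open>M = 1\<close> of
  \<open>entropy_le_scaled\<close>, which would reverse the inequality of entropies.\<close>

lemma not_dominated_if_entropy_less:
  assumes X: "finite_alphabet_shift X E" and Y: "finite_alphabet_shift Y F"
    and less: "topological_entropy Y < topological_entropy X" and "c > 0"
  shows "\<not> (\<forall>\<^sub>F n in sequentially. c * real (complexity X n) \<le> real (complexity Y n))"
proof
  assume "\<forall>\<^sub>F n in sequentially. c * real (complexity X n) \<le> real (complexity Y n)"
  then have "\<forall>\<^sub>F n in sequentially. real (complexity X n) \<le> 1 / c * real (complexity Y (1 * n))"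
    by eventually_elim (use \<open>c > 0\<close> in \<open>simp add: field_simps\<close>)
  then have "topological_entropy X \<le> real 1 * topological_entropy Y"
    using \<open>c > 0\<close> by (intro entropy_le_scaled[OF Y X, of "1 / c"]) auto
  then show False using less by simp
qed

theorem proposition1p4:
  fixes G :: "('g, 'm) monoid_scheme" and N :: nat and S :: "'g set"
  assumes "free_group_of_rank G N" and "N \<ge> 2"
    and "finite S" and "S \<subseteq> carrier G" and "generate G S = carrier G"
  shows
    "(\<forall>A B L. free_basis G A \<and> free_basis G B \<and> algebraic_lamination G S L \<longrightarrow>
        (\<exists>c>0. \<exists>d>0. \<exists>C>0. \<exists>D>0. complexity_bounds c d C D
          (complexity (lamination_subshift G S A L)) (complexity (lamination_subshift G S B L)))) \<and>
     (\<exists>A B L. free_basis G A \<and> free_basis G B \<and> algebraic_lamination G S L \<and>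
        \<not> (\<exists>C>0. \<exists>D>0. complexity_bounds 1 1 C D
          (complexity (lamination_subshift G S A L)) (complexity (lamination_subshift G S B L)))) \<and>
     (\<exists>A B L. free_basis G A \<and> free_basis G B \<and> algebraic_lamination G S L \<and>
        (\<lambda>n. real (complexity (lamination_subshift G S B L) n)) \<notin>
          \<Theta>(\<lambda>n. real (complexity (lamination_subshift G S A L) n))) \<and>
     (\<exists>A B L. free_basis G A \<and> free_basis G B \<and> algebraic_lamination G S L \<and>
        topological_entropy (lamination_subshift G S A L) \<noteq>
          topological_entropy (lamination_subshift G S B L)) \<and>
     (\<forall>A B L. free_basis G A \<and> free_basis G B \<and> algebraic_lamination G S L \<longrightarrow>
        (topological_entropy (lamination_subshift G S A L) = 0 \<longleftrightarrow>
          topological_entropy (lamination_subshift G S B L) = 0))"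
proof -
  obtain B where B: "free_basis G B" "card B = N" and G: "group G"
    using assms(1) unfolding free_group_of_rank_def by blast
  have based: "based_group G A" if "free_basis G A" for A
    using G that by (simp add: based_group_def based_group_axioms_def)
  have S: "generated_group G S"
    using G assms by (simp add: generated_group_def generated_group_axioms_def)
  interpret B: based_group G B by (rule based[OF B(1)])
  obtain b b' where bb: "b \<in> B" "b' \<in> B" "b \<noteq> b'"
    using B(2) assms(2) card_le_Suc0_iff_eq[OF B.finite_basis[OF S]] by fastforce
  obtain A L where A: "free_basis G A" and L: "algebraic_lamination G S L"
    and gap: "topological_entropy (lamination_subshift G S B L) < topological_entropy (lamination_subshift G S A L)"
    using B.entropy_gap[OF S bb] by blast
  \<comment> \<open>The entropy over \<open>A\<close> is the larger one, so \<open>A\<close> takes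
    the first place: with \<open>c = d = 1\<close> the lower bound on \<open>?q\<close> fails, and
    so does the lower half of \<Theta>.\<close>
  let ?p = "complexity (lamination_subshift G S A L)" and ?q = "complexity (lamination_subshift G S B L)"
  have not_dom: "\<not> (\<forall>\<^sub>F n in sequentially. c * real (?p n) \<le> real (?q n))" if "c > 0" for c
    by (rule not_dominated_if_entropy_less[OF
          finite_alphabet_lamination_subshift[OF based[OF A] S L]
          finite_alphabet_lamination_subshift[OF based[OF B(1)] S L] gap that])
  have "\<not> (\<exists>C>0. \<exists>D>0. complexity_bounds 1 1 C D ?p ?q)"
  proof
    assume "\<exists>C>0. \<exists>D>0. complexity_bounds 1 1 C D ?p ?q"
    then obtain C D where "complexity_bounds 1 1 C D ?p ?q" by blast
    then have "\<forall>\<^sub>F n in sequentially. 1 * real (?p n) \<le> real (?q n)"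
      unfolding complexity_bounds_def by eventually_elim simp
    then show False using not_dom[of 1] by simp
  qed
  moreover have "(\<lambda>n. real (?q n)) \<notin> \<Theta>(\<lambda>n. real (?p n))"
  proof
    assume "(\<lambda>n. real (?q n)) \<in> \<Theta>(\<lambda>n. real (?p n))"
    then have "(\<lambda>n. real (?q n)) \<in> \<Omega>(\<lambda>n. real (?p n))" by (simp add: bigtheta_def)
    then obtain c where "c > 0" "\<forall>\<^sub>F n in sequentially. norm (real (?q n)) \<ge> c * norm (real (?p n))"
      by (rule landau_omega.bigE)
    then show False using not_dom by simp
  qed
  moreover have "topological_entropy (lamination_subshift G S A L)
      \<noteq> topological_entropy (lamination_subshift G S B L)" using gap by simp
  moreover have "topological_entropy (lamination_subshift G S A' L') = 0 \<longleftrightarrow>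
      topological_entropy (lamination_subshift G S B' L') = 0"
    if "free_basis G A'" "free_basis G B'" "algebraic_lamination G S L'" for A' B' L'
    using lamination_entropy_zero based S that by meson
  moreover have "\<exists>c>0. \<exists>d>0. \<exists>C>0. \<exists>D>0. complexity_bounds c d C D
      (complexity (lamination_subshift G S A' L')) (complexity (lamination_subshift G S B' L'))"
    if "free_basis G A'" "free_basis G B'" "algebraic_lamination G S L'" for A' B' L'
    using lamination_complexity_bounds based S that by blast
  ultimately show ?thesis using A B(1) L by (intro conjI) blast+
qed

end
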